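(* Let $1\le p<\infty$ and let $X,Y$ be Banach spaces. (i) If $X^*$ has the $p$-$(DPrcP)$ and $Y$ has the Schur property, then $L(X,Y)$ has the $p$-$(DPrcP)$. (ii) If $X$ has the $p$-$(DPrcP)$ and $Y$ has the Schur property, then $L_{w^*}(X^*,Y)$ has the $p$-$(DPrcP)$. (iii) If $X^*$ has the $p$-$(DPrcP)$, then $\ell_1^w(X^* )$ has the $p$-$(DPrcP)$.
   Context: A sequence $(x_n)_n$ in a Banach space $X$ is weakly $p$-summable if $(x^*(x_n))_n\in\ell_p$ for every $x^*\in X^*$. A bounded set $K\subseteq X$ is a Dunford-Pettis set if every weakly null sequence $(x_n^* )_n$ in $X^*$ converges to $0$ uniformly on $K$. A Banach space $X$ has the $p$-Dunford-Pettis relatively compact property ($p$-$(DPrcP)$) if every weakly $p$-summable sequence in $X$ whose set of terms is a Dunford-Pettis set is norm null. A Banach space has the Schur property if weakly null sequences in it are norm null. $L(X,Y)$ is the space of bounded linear operators $X\to Y$, and $L_{w^*}(X^*,Y)$ is the space of all $w^*$-$w$ continuous operators from $X^*$ to $Y$, both with the operator norm. $\ell_1^w(Z)$ is the space of weakly $1$-summable sequences $(z_n)_n$ in a Banach space $Z$, with its usual norm $\sup\{\sum_n|z^*(z_n)|: z^*\in Z^*,\ \|z^*\|\le1\}$. *)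

theory Defs
  imports "HOL-Analysis.Analysis"
begin

section \<open>Functionals separate points\<close>

text \<open>HOL-Analysis has no Hahn-Banach theorem. It is needed below to see that the norm of
  \<open>\<ell>\<^sub>1\<^sup>w(Z)\<close> is definite and that \<open>\<ell>\<^sub>1\<^sup>w(Z)\<close> and \<open>L\<^sub>w\<^sub>*(X\<^sup>*,Y)\<close> are complete. The proof takes a minimal
  sublinear functional below the given one; minimality forces linearity.\<close>

definition sublinear :: "('a::real_vector \<Rightarrow> real) \<Rightarrow> bool" where
  "sublinear p \<longleftrightarrow> (\<forall>x y. p (x + y) \<le> p x + p y) \<and> (\<forall>a>0. \<forall>x. p (a *\<^sub>R x) \<le> a * p x) \<and> p 0 = 0"

lemma sublinear_add: "sublinear p \<Longrightarrow> p (x + y) \<le> p x + p y"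
  by (simp add: sublinear_def)

lemma sublinear_0: "sublinear p \<Longrightarrow> p 0 = 0"
  by (simp add: sublinear_def)

lemma sublinear_scale:
  assumes "sublinear p" "a \<ge> 0"
  shows "p (a *\<^sub>R x) = a * p x"
proof (cases "a = 0")
  case True
  then show ?thesis using assms by (simp add: sublinear_def)
next
  case False
  then have a: "a > 0" using assms by simp
  have "p (inverse a *\<^sub>R (a *\<^sub>R x)) \<le> inverse a * p (a *\<^sub>R x)"
    using assms a unfolding sublinear_def by (metis positive_imp_inverse_positive)
  then have "a * p x \<le> p (a *\<^sub>R x)"
    using a by (simp add: field_simps)
  moreover have "p (a *\<^sub>R x) \<le> a * p x"
    using assms a unfolding sublinear_def by blast
  ultimately show ?thesis by simp
qed

lemma sublinear_ge: "sublinear p \<Longrightarrow> - p (- x) \<le> p x"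
  using sublinear_add[of p x "- x"] sublinear_0[of p] by simp

lemma sublinear_shift:
  fixes p :: "'a::real_vector \<Rightarrow> real"
  assumes p: "sublinear p"
  obtains q where "sublinear q" "\<And>x. q x \<le> p x" "\<And>x. q x \<le> p (x + y) - p y"
proof -
  define q where "q = (\<lambda>x. INF t\<in>{0..}. p (x + t *\<^sub>R y) - t * p y)"
  have lower: "- p (- x) \<le> p (x + t *\<^sub>R y) - t * p y" if "t \<ge> 0" for x t
    using sublinear_add[OF p, of "x + t *\<^sub>R y" "- x"] sublinear_scale[OF p that, of y] by simp
  have bdd: "bdd_below ((\<lambda>t. p (x + t *\<^sub>R y) - t * p y) ` {0..})" for x
    using lower by (intro bdd_belowI2[where m = "- p (- x)"]) auto
  have le: "q x \<le> p (x + t *\<^sub>R y) - t * p y" if "t \<ge> 0" for x t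
    unfolding q_def using that by (intro cINF_lower[OF bdd]) auto
  have ge: "b \<le> q x" if "\<And>t. t \<ge> 0 \<Longrightarrow> b \<le> p (x + t *\<^sub>R y) - t * p y" for b x
    unfolding q_def using that by (intro cINF_greatest) auto
  have "sublinear q"
    unfolding sublinear_def
  proof (intro conjI allI impI)
    fix x z
    have *: "q (x + z) \<le> (p (x + t *\<^sub>R y) - t * p y) + (p (z + s *\<^sub>R y) - s * p y)"
      if "t \<ge> 0" "s \<ge> 0" for s t
    proof -
      have "q (x + z) \<le> p (x + z + (t + s) *\<^sub>R y) - (t + s) * p y"
        using that by (intro le) auto
      also have "x + z + (t + s) *\<^sub>R y = (x + t *\<^sub>R y) + (z + s *\<^sub>R y)"
        by (simp add: algebra_simps)
      finally show ?thesis
        using sublinear_add[OF p, of "x + t *\<^sub>R y" "z + s *\<^sub>R y"] by (simp add: algebra_simps)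
    qed
    have "q (x + z) - q x \<le> q z"
    proof (rule ge)
      fix s :: real assume s: "s \<ge> 0"
      have "q (x + z) - (p (z + s *\<^sub>R y) - s * p y) \<le> q x"
      proof (rule ge)
        fix t :: real assume "t \<ge> 0"
        then show "q (x + z) - (p (z + s *\<^sub>R y) - s * p y) \<le> p (x + t *\<^sub>R y) - t * p y"
          using *[OF _ s] by smt
      qed
      then show "q (x + z) - q x \<le> p (z + s *\<^sub>R y) - s * p y" by linarith
    qed
    then show "q (x + z) \<le> q x + q z" by linarith
  next
    fix a :: real and x
    assume a: "a > 0"
    have "q (a *\<^sub>R x) / a \<le> q x"
    proof (rule ge)
      fix t :: real assume t: "t \<ge> 0"
      have "q (a *\<^sub>R x) \<le> p (a *\<^sub>R x + (a * t) *\<^sub>R y) - (a * t) * p y"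
        using a t by (intro le) auto
      also have "a *\<^sub>R x + (a * t) *\<^sub>R y = a *\<^sub>R (x + t *\<^sub>R y)"
        by (simp add: algebra_simps)
      also have "p \<dots> = a * p (x + t *\<^sub>R y)"
        using a by (intro sublinear_scale[OF p]) auto
      finally show "q (a *\<^sub>R x) / a \<le> p (x + t *\<^sub>R y) - t * p y"
        using a by (simp add: field_simps)
    qed
    then show "q (a *\<^sub>R x) \<le> a * q x"
      using a by (simp add: field_simps)
  next
    have "q 0 \<le> 0" using le[of 0 0] sublinear_0[OF p] by simp
    moreover have "0 \<le> q 0" using sublinear_scale[OF p] by (intro ge) auto
    ultimately show "q 0 = 0" by simp
  qed
  moreover have "q x \<le> p x" for x using le[of 0 x] by simp
  moreover have "q x \<le> p (x + y) - p y" for x using le[of 1 x] by simp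
  ultimately show ?thesis by (rule that)
qed

lemma sublinear_above_linear:
  fixes p :: "'a::real_vector \<Rightarrow> real"
  assumes p: "sublinear p"
  obtains f where "linear f" "\<And>x. f x \<le> p x"
proof -
  define A where "A = {q. sublinear q \<and> (\<forall>x. q x \<le> p x)}"
  define P where "P = (\<lambda>q r :: 'a \<Rightarrow> real. \<forall>x. r x \<le> q x)"
  have "\<exists>m\<in>A. \<forall>a\<in>A. P m a \<longrightarrow> a = m"
  proof (rule predicate_Zorn)
    show "partial_order_on A (relation_of P A)"
      by (rule partial_order_on_relation_ofI)
        (auto simp: P_def fun_eq_iff intro: order.trans order.antisym)
  next
    fix C assume C: "C \<in> Chains (relation_of P A)"
    then have CA: "C \<subseteq> A" by (rule Chains_relation_of)
    have tot: "P q r \<or> P r q" if "q \<in> C" "r \<in> C" for q r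
      using C that unfolding Chains_def relation_of_def by blast
    show "\<exists>u\<in>A. \<forall>a\<in>C. P a u"
    proof (cases "C = {}")
      case True
      then show ?thesis using p by (auto simp: A_def)
    next
      case False
      define u where "u = (\<lambda>x. INF q\<in>C. q x)"
      have lower: "- p (- x) \<le> q x" if "q \<in> C" for q x
        using that CA sublinear_ge[of q x] unfolding A_def by (smt (verit) mem_Collect_eq subsetD)
      have bdd: "bdd_below ((\<lambda>q. q x) ` C)" for x
        using lower by (intro bdd_belowI2[where m = "- p (- x)"]) auto
      have le: "u x \<le> q x" if "q \<in> C" for q x
        unfolding u_def using that by (intro cINF_lower[OF bdd]) auto
      have ge: "b \<le> u x" if "\<And>q. q \<in> C \<Longrightarrow> b \<le> q x" for b x
        unfolding u_def using that False by (intro cINF_greatest) auto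
      have sub: "sublinear q" if "q \<in> C" for q using that CA by (auto simp: A_def)
      have "sublinear u"
        unfolding sublinear_def
      proof (intro conjI allI impI)
        fix x y
        have *: "u (x + y) \<le> q x + r y" if "q \<in> C" "r \<in> C" for q r
          using tot[OF that]
        proof
          assume "P q r"
          then show ?thesis
            using le[OF that(2), of "x + y"] sublinear_add[OF sub[OF that(2)], of x y]
            unfolding P_def by (smt (verit))
        next
          assume "P r q"
          then show ?thesis
            using le[OF that(1), of "x + y"] sublinear_add[OF sub[OF that(1)], of x y]
            unfolding P_def by (smt (verit))
        qed
        have "u (x + y) - u x \<le> u y"
        proof (rule ge)
          fix r assume r: "r \<in> C"
          have "u (x + y) - r y \<le> u x"
            using *[OF _ r] by (intro ge) (smt (verit))
          then show "u (x + y) - u x \<le> r y" by linarith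
        qed
        then show "u (x + y) \<le> u x + u y" by linarith
      next
        fix a :: real and x assume a: "a > 0"
        have "u (a *\<^sub>R x) / a \<le> u x"
        proof (rule ge)
          fix q assume q: "q \<in> C"
          have "u (a *\<^sub>R x) \<le> a * q x"
            using le[OF q, of "a *\<^sub>R x"] sublinear_scale[OF sub[OF q], of a x] a by simp
          then show "u (a *\<^sub>R x) / a \<le> q x" using a by (simp add: field_simps)
        qed
        then show "u (a *\<^sub>R x) \<le> a * u x" using a by (simp add: field_simps)
      next
        have "(\<lambda>q. q 0) ` C = {0}"
          using False sublinear_0[OF sub] by force
        then show "u 0 = 0" by (simp add: u_def)
      qed
      moreover have "u x \<le> p x" for x
      proof -
        obtain q where "q \<in> C" using False by blast
        then show ?thesis using le[of q x] CA unfolding A_def by (smt (verit) mem_Collect_eq subsetD)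
      qed
      ultimately show ?thesis using le by (auto simp: A_def P_def intro!: bexI[of _ u])
    qed
  qed
  then obtain f where f: "f \<in> A" and min: "\<And>a. a \<in> A \<Longrightarrow> P f a \<Longrightarrow> a = f" by blast
  have subf: "sublinear f" and fp: "\<And>x. f x \<le> p x" using f by (auto simp: A_def)
  have add: "f (x + y) = f x + f y" for x y
  proof -
    obtain q where q: "sublinear q" "\<And>x. q x \<le> f x" "\<And>x. q x \<le> f (x + y) - f y"
      using sublinear_shift[OF subf] by metis
    have "q = f"
      using q fp by (intro min) (auto simp: A_def P_def intro: order.trans)
    then show ?thesis using q(3)[of x] sublinear_add[OF subf, of x y] by simp
  qed
  have neg: "f (- x) = - f x" for x
    using add[of x "- x"] sublinear_0[OF subf] by simp
  have "linear f"
  proof (rule linearI)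
    fix a x
    show "f (a *\<^sub>R x) = a *\<^sub>R f x"
    proof (cases "a \<ge> 0")
      case True
      then show ?thesis using sublinear_scale[OF subf] by simp
    next
      case False
      then have "f ((- a) *\<^sub>R x) = (- a) * f x" by (intro sublinear_scale[OF subf]) auto
      then show ?thesis using neg[of "a *\<^sub>R x"] by simp
    qed
  qed (rule add)
  then show ?thesis using fp by (rule that)
qed

lemma norming_functional:
  fixes x :: "'a::real_normed_vector"
  obtains f :: "'a \<Rightarrow>\<^sub>L real" where "norm f \<le> 1" "f x = norm x"
proof -
  have "sublinear (norm :: 'a \<Rightarrow> real)"
    by (auto simp: sublinear_def norm_triangle_ineq)
  then obtain q where q: "sublinear q" "\<And>z. q z \<le> norm z" "\<And>z. q z \<le> norm (z + x) - norm x"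
    using sublinear_shift[of norm x] by metis
  obtain f where f: "linear f" "\<And>z. f z \<le> q z"
    using sublinear_above_linear[OF q(1)] by blast
  have le: "\<bar>f z\<bar> \<le> norm z" for z
    using f(2)[of z] f(2)[of "- z"] q(2)[of z] q(2)[of "- z"] linear_neg[OF f(1), of z] by auto
  have bl: "bounded_linear f"
    using f(1) le by (intro bounded_linear_intro[where K = 1])
      (auto simp: linear_add linear_scale)
  have "f (- x) \<le> - norm x" using f(2)[of "- x"] q(3)[of "- x"] by simp
  then have "f x = norm x" using le[of x] linear_neg[OF f(1), of x] by auto
  moreover have "norm (Blinfun f) \<le> 1"
    using le by (intro norm_blinfun_bound) (auto simp: bounded_linear_Blinfun_apply[OF bl])
  ultimately show ?thesis
    using that[of "Blinfun f"] by (simp add: bounded_linear_Blinfun_apply[OF bl])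
qed


section \<open>Weak topologies, sequences and the geometric properties\<close>

definition weak_topology :: "'a::real_normed_vector topology" where
  "weak_topology = pullback_topology UNIV (\<lambda>x (f :: 'a \<Rightarrow>\<^sub>L real). blinfun_apply f x) euclidean"

text \<open>For scalar-valued operators the strong operator topology is pointwise convergence on \<open>X\<close>,
  i.e. the weak-star topology of \<open>X\<^sup>*\<close>.\<close>

abbreviation weak_star_topology :: "('a::real_normed_vector \<Rightarrow>\<^sub>L real) topology" where
  "weak_star_topology \<equiv> strong_operator_topology"

definition weakly_summable :: "real \<Rightarrow> (nat \<Rightarrow> 'a::real_normed_vector) \<Rightarrow> bool" where
  "weakly_summable p x \<longleftrightarrow> (\<forall>f :: 'a \<Rightarrow>\<^sub>L real. summable (\<lambda>n. \<bar>f (x n)\<bar> powr p))"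

definition weakly_null :: "(nat \<Rightarrow> 'a::real_normed_vector) \<Rightarrow> bool" where
  "weakly_null x \<longleftrightarrow> (\<forall>f :: 'a \<Rightarrow>\<^sub>L real. (\<lambda>n. f (x n)) \<longlonglongrightarrow> 0)"

definition dunford_pettis_set :: "'a::real_normed_vector set \<Rightarrow> bool" where
  "dunford_pettis_set K \<longleftrightarrow> bounded K \<and>
    (\<forall>f :: nat \<Rightarrow> 'a \<Rightarrow>\<^sub>L real. weakly_null f \<longrightarrow>
      uniform_limit K (\<lambda>n x. blinfun_apply (f n) x) (\<lambda>_. 0) sequentially)"

definition DPrcP :: "real \<Rightarrow> 'a::banach itself \<Rightarrow> bool" where
  "DPrcP p _ \<longleftrightarrow> (\<forall>x :: nat \<Rightarrow> 'a.
    weakly_summable p x \<and> dunford_pettis_set (range x) \<longrightarrow> x \<longlonglongrightarrow> 0)"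

definition schur_property :: "'a::banach itself \<Rightarrow> bool" where
  "schur_property _ \<longleftrightarrow> (\<forall>x :: nat \<Rightarrow> 'a. weakly_null x \<longrightarrow> x \<longlonglongrightarrow> 0)"


lemma topspace_weak_topology [simp]: "topspace weak_topology = UNIV"
  by (simp add: weak_topology_def topspace_pullback_topology)


section \<open>The space of weak-star to weak continuous operators\<close>

typedef (overloaded) ('a, 'b) wstar_op =
  "{T :: ('a::real_normed_vector \<Rightarrow>\<^sub>L real) \<Rightarrow>\<^sub>L 'b::real_normed_vector.
     continuous_map weak_star_topology weak_topology (blinfun_apply T)}"
  morphisms blinfun_of_wstar Wstar_op
proof
  show "0 \<in> {T :: ('a \<Rightarrow>\<^sub>L real) \<Rightarrow>\<^sub>L 'b.
     continuous_map weak_star_topology weak_topology (blinfun_apply T)}"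
    by (simp add: zero_blinfun.rep_eq)
qed

setup_lifting type_definition_wstar_op

lemma continuous_map_weak_topology_iff:
  "continuous_map S weak_topology h \<longleftrightarrow>
    (\<forall>f :: 'b::real_normed_vector \<Rightarrow>\<^sub>L real. continuous_map S euclideanreal (\<lambda>x. f (h x)))"
  (is "?L \<longleftrightarrow> ?R")
proof -
  let ?e = "\<lambda>(x :: 'b) (f :: 'b \<Rightarrow>\<^sub>L real). blinfun_apply f x"
  have "?L \<longleftrightarrow> continuous_map S euclidean (?e \<circ> h)"
  proof
    assume "continuous_map S euclidean (?e \<circ> h)"
    then show ?L unfolding weak_topology_def by (intro continuous_map_pullback') auto
  next
    assume L: ?L
    have "continuous_map weak_topology euclidean (id \<circ> ?e)"
      unfolding weak_topology_def by (intro continuous_map_pullback) auto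
    from continuous_map_compose[OF L this] show "continuous_map S euclidean (?e \<circ> h)"
      by (simp add: o_def)
  qed
  also have "\<dots> \<longleftrightarrow> ?R"
    by (simp add: euclidean_product_topology[symmetric] continuous_map_componentwise_UNIV o_def)
  finally show ?thesis .
qed

instantiation wstar_op :: (real_normed_vector, real_normed_vector) real_normed_vector
begin

lift_definition zero_wstar_op :: "('a, 'b) wstar_op" is 0
  by (simp add: zero_blinfun.rep_eq continuous_map_weak_topology_iff)

lift_definition plus_wstar_op :: "('a, 'b) wstar_op \<Rightarrow> ('a, 'b) wstar_op \<Rightarrow> ('a, 'b) wstar_op" is "(+)"
  by (simp add: continuous_map_weak_topology_iff blinfun.bilinear_simps continuous_map_add)

lift_definition minus_wstar_op :: "('a, 'b) wstar_op \<Rightarrow> ('a, 'b) wstar_op \<Rightarrow> ('a, 'b) wstar_op" is "(-)"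
  by (simp add: continuous_map_weak_topology_iff blinfun.bilinear_simps continuous_map_diff)

lift_definition uminus_wstar_op :: "('a, 'b) wstar_op \<Rightarrow> ('a, 'b) wstar_op" is uminus
  by (simp add: continuous_map_weak_topology_iff blinfun.bilinear_simps continuous_map_minus)

lift_definition scaleR_wstar_op :: "real \<Rightarrow> ('a, 'b) wstar_op \<Rightarrow> ('a, 'b) wstar_op" is "scaleR"
  by (simp add: continuous_map_weak_topology_iff blinfun.bilinear_simps continuous_map_real_mult_left)

lift_definition norm_wstar_op :: "('a, 'b) wstar_op \<Rightarrow> real" is norm .

definition dist_wstar_op :: "('a, 'b) wstar_op \<Rightarrow> ('a, 'b) wstar_op \<Rightarrow> real"
  where "dist_wstar_op S T = norm (S - T)"

definition sgn_wstar_op :: "('a, 'b) wstar_op \<Rightarrow> ('a, 'b) wstar_op"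
  where "sgn_wstar_op T = inverse (norm T) *\<^sub>R T"

definition uniformity_wstar_op :: "(('a, 'b) wstar_op \<times> ('a, 'b) wstar_op) filter"
  where "uniformity_wstar_op = (INF e\<in>{0 <..}. principal {(x, y). dist x y < e})"

definition open_wstar_op :: "('a, 'b) wstar_op set \<Rightarrow> bool"
  where "open_wstar_op S = (\<forall>x\<in>S. \<forall>\<^sub>F (x', y) in uniformity. x' = x \<longrightarrow> y \<in> S)"

instance
proof
  fix R S T :: "('a, 'b) wstar_op" and a b :: real
  show "R + S + T = R + (S + T)" by transfer (simp add: algebra_simps)
  show "R + S = S + R" by transfer (simp add: algebra_simps)
  show "0 + S = S" by transfer simp
  show "- S + S = 0" by transfer simp
  show "R - S = R + - S" by transfer simp
  show "a *\<^sub>R (R + S) = a *\<^sub>R R + a *\<^sub>R S" by transfer (simp add: algebra_simps)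
  show "(a + b) *\<^sub>R S = a *\<^sub>R S + b *\<^sub>R S" by transfer (simp add: algebra_simps)
  show "a *\<^sub>R b *\<^sub>R S = (a * b) *\<^sub>R S" by transfer simp
  show "1 *\<^sub>R S = S" by transfer simp
  show "norm S = 0 \<longleftrightarrow> S = 0" by transfer simp
  show "norm (R + S) \<le> norm R + norm S" by transfer (rule norm_triangle_ineq)
  show "norm (a *\<^sub>R S) = \<bar>a\<bar> * norm S" by transfer simp
qed (rule dist_wstar_op_def sgn_wstar_op_def uniformity_wstar_op_def open_wstar_op_def)+

end

lemma kernel_finite_imp_evaluation:
  fixes \<phi> :: "('a::real_normed_vector \<Rightarrow>\<^sub>L real) \<Rightarrow> real"
  assumes "finite F" "linear \<phi>" "\<And>f. (\<forall>x\<in>F. blinfun_apply f x = 0) \<Longrightarrow> \<phi> f = 0"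
  shows "\<exists>y. \<forall>f. \<phi> f = blinfun_apply f y"
  using assms
proof (induction F arbitrary: \<phi> rule: finite_induct)
  case empty
  then show ?case by (auto intro!: exI[of _ 0])
next
  case (insert a F)
  interpret linear \<phi> by fact
  show ?case
  proof (cases "\<forall>f :: 'a \<Rightarrow>\<^sub>L real. (\<forall>x\<in>F. blinfun_apply f x = 0) \<longrightarrow> blinfun_apply f a = 0")
    case True
    then have "\<phi> f = 0" if "\<forall>x\<in>F. blinfun_apply f x = 0" for f
      using that by (intro insert.prems(2)) blast
    then show ?thesis using insert.IH insert.prems(1) by blast
  next
    case False
    then obtain g :: "'a \<Rightarrow>\<^sub>L real" where g: "\<forall>x\<in>F. blinfun_apply g x = 0" "blinfun_apply g a \<noteq> 0" by blast
    define h where "h = g /\<^sub>R blinfun_apply g a"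
    have h: "\<forall>x\<in>F. blinfun_apply h x = 0" "blinfun_apply h a = 1"
      using g by (simp_all add: h_def blinfun.bilinear_simps)
    define \<psi> where "\<psi> = (\<lambda>f. \<phi> f - \<phi> h * blinfun_apply f a)"
    have "linear \<psi>"
      by (rule linearI) (simp_all add: \<psi>_def add scale blinfun.bilinear_simps algebra_simps)
    moreover have "\<psi> f = 0" if "\<forall>x\<in>F. blinfun_apply f x = 0" for f
    proof -
      have "\<phi> (f - blinfun_apply f a *\<^sub>R h) = 0"
        using that h by (intro insert.prems(2)) (simp add: blinfun.bilinear_simps)
      then show ?thesis by (simp add: \<psi>_def diff scale)
    qed
    ultimately obtain y where y: "\<forall>f. \<psi> f = blinfun_apply f y"
      using insert.IH by blast
    have "\<phi> f = blinfun_apply f (y + \<phi> h *\<^sub>R a)" for f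
    proof -
      have "\<phi> f = blinfun_apply f y + \<phi> h * blinfun_apply f a"
        using y[rule_format, of f] unfolding \<psi>_def by linarith
      then show ?thesis by (simp only: blinfun.add_right blinfun.scaleR_right real_scaleR_def)
    qed
    then show ?thesis by blast
  qed
qed

lemma weak_star_continuous_imp_evaluation:
  fixes \<phi> :: "('a::real_normed_vector \<Rightarrow>\<^sub>L real) \<Rightarrow> real"
  assumes lin: "linear \<phi>" and cont: "continuous_map weak_star_topology euclideanreal \<phi>"
  shows "\<exists>y. \<forall>f. \<phi> f = blinfun_apply f y"
proof -
  interpret linear \<phi> by fact
  have "openin weak_star_topology {f. \<phi> f \<in> ball 0 1}"
    using openin_continuous_map_preimage[OF cont, of "ball 0 1"]
    by (simp add: strong_operator_topology_topspace)
  then obtain U :: "('a \<Rightarrow> real) set" where U: "open U" "{f. \<phi> f \<in> ball 0 1} = blinfun_apply -` U"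
    unfolding strong_operator_topology_def by (auto simp: openin_pullback_topology)
  have "(0 :: 'a \<Rightarrow>\<^sub>L real) \<in> {f. \<phi> f \<in> ball 0 1}" using zero by simp
  then have 0: "(\<lambda>_. 0) \<in> U" unfolding U(2) by (simp add: zero_blinfun.rep_eq)
  have "openin (product_topology (\<lambda>i. euclidean) UNIV) U"
    using U(1) by (simp add: open_fun_def)
  from product_topology_open_contains_basis[OF this 0] obtain X
    where X: "(\<lambda>_. 0) \<in> (\<Pi>\<^sub>E i\<in>UNIV. X i)" "finite {i. X i \<noteq> UNIV}" "(\<Pi>\<^sub>E i\<in>UNIV. X i) \<subseteq> U"
    by auto
  have small: "\<bar>\<phi> f\<bar> < 1" if "\<forall>x\<in>{i. X i \<noteq> UNIV}. blinfun_apply f x = 0" for f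
  proof -
    have "blinfun_apply f x \<in> X x" for x
      using that X(1) by (cases "X x = UNIV") (auto simp: PiE_iff)
    then have "blinfun_apply f \<in> U" using X(3) by (auto simp: PiE_iff)
    then have "f \<in> {f. \<phi> f \<in> ball 0 1}" unfolding U(2) by simp
    then show ?thesis by simp
  qed
  show ?thesis
  proof (rule kernel_finite_imp_evaluation[OF X(2) lin])
    fix f :: "'a \<Rightarrow>\<^sub>L real" assume f: "\<forall>x\<in>{i. X i \<noteq> UNIV}. blinfun_apply f x = 0"
    show "\<phi> f = 0"
    proof (rule ccontr)
      assume "\<phi> f \<noteq> 0"
      then have "\<phi> (inverse (\<phi> f) *\<^sub>R f) = 1" by (simp add: scale)
      moreover have "\<bar>\<phi> (inverse (\<phi> f) *\<^sub>R f)\<bar> < 1"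
        using f by (intro small) (simp add: blinfun.bilinear_simps)
      ultimately show False by simp
    qed
  qed
qed

instance wstar_op :: (banach, banach) banach
proof
  fix T :: "nat \<Rightarrow> ('a, 'b) wstar_op"
  assume Cau: "Cauchy T"
  have norm_diff: "norm (blinfun_of_wstar S - blinfun_of_wstar R) = norm (S - R)"
    for S R :: "('a, 'b) wstar_op"
    by transfer simp
  have "Cauchy (\<lambda>n. blinfun_of_wstar (T n))"
    using Cau by (simp add: Cauchy_iff norm_diff)
  then obtain L where L: "(\<lambda>n. blinfun_of_wstar (T n)) \<longlonglongrightarrow> L"
    by (auto simp: Cauchy_convergent_iff convergent_def)
  have cont: "continuous_map weak_star_topology weak_topology (blinfun_apply L)"
    unfolding continuous_map_weak_topology_iff
  proof
    fix g :: "'b \<Rightarrow>\<^sub>L real"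
    have "\<exists>x. \<forall>f. g (blinfun_of_wstar (T n) f) = blinfun_apply f x" for n
    proof (rule weak_star_continuous_imp_evaluation)
      show "linear (\<lambda>f. g (blinfun_of_wstar (T n) f))"
        by (rule linearI) (simp_all add: blinfun.bilinear_simps)
      show "continuous_map weak_star_topology euclideanreal (\<lambda>f. g (blinfun_of_wstar (T n) f))"
        using blinfun_of_wstar[of "T n"] by (simp add: continuous_map_weak_topology_iff)
    qed
    then obtain x where x: "\<And>n f. g (blinfun_of_wstar (T n) f) = blinfun_apply f (x n)" by metis
    have diff: "norm (x n - x m) \<le> norm g * norm (T n - T m)" for n m
    proof -
      obtain f :: "'a \<Rightarrow>\<^sub>L real" where f: "norm f \<le> 1" "f (x n - x m) = norm (x n - x m)"
        by (rule norming_functional)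
      have "norm (x n - x m) = g ((blinfun_of_wstar (T n) - blinfun_of_wstar (T m)) f)"
        using f(2) x by (simp add: blinfun.bilinear_simps)
      also have "\<dots> \<le> norm g * norm ((blinfun_of_wstar (T n) - blinfun_of_wstar (T m)) f)"
        using norm_blinfun[of g] by (metis abs_le_D1 real_norm_def)
      also have "norm ((blinfun_of_wstar (T n) - blinfun_of_wstar (T m)) f)
          \<le> norm (blinfun_of_wstar (T n) - blinfun_of_wstar (T m)) * norm f"
        by (rule norm_blinfun)
      also have "\<dots> \<le> norm (T n - T m) * 1"
        unfolding norm_diff using f(1) by (intro mult_left_mono) auto
      finally show ?thesis by (simp add: mult_left_mono)
    qed
    have "Cauchy x"
    proof (rule CauchyI)
      fix e :: real assume e: "e > 0"
      obtain M where M: "\<And>m n. m \<ge> M \<Longrightarrow> n \<ge> M \<Longrightarrow> norm (T m - T n) < e / (norm g + 1)"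
        using CauchyD[OF Cau, of "e / (norm g + 1)"] e
        by (metis add_nonneg_pos divide_pos_pos norm_ge_zero zero_less_one)
      have "norm (x m - x n) < e" if "m \<ge> M" "n \<ge> M" for m n
      proof -
        have "norm (x m - x n) \<le> (norm g + 1) * norm (T m - T n)"
          using diff[of m n] by (simp add: algebra_simps add_increasing)
        also have "\<dots> < (norm g + 1) * (e / (norm g + 1))"
          using M[OF that] by (intro mult_strict_left_mono) (auto simp: add_nonneg_pos)
        also have "\<dots> = e" by (metis add_nonneg_pos less_irrefl nonzero_mult_div_cancel_left
              norm_ge_zero times_divide_eq_right zero_less_one)
        finally show ?thesis .
      qed
      then show "\<exists>M. \<forall>m\<ge>M. \<forall>n\<ge>M. norm (x m - x n) < e" by blast
    qed
    then obtain y where y: "x \<longlonglongrightarrow> y" by (auto simp: Cauchy_convergent_iff convergent_def)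
    have "g (L f) = blinfun_apply f y" for f
    proof (rule LIMSEQ_unique)
      show "(\<lambda>n. g (blinfun_of_wstar (T n) f)) \<longlonglongrightarrow> g (L f)"
        by (intro tendsto_intros L)
      show "(\<lambda>n. g (blinfun_of_wstar (T n) f)) \<longlonglongrightarrow> blinfun_apply f y"
        unfolding x by (intro tendsto_intros y)
    qed
    then show "continuous_map weak_star_topology euclideanreal (\<lambda>f. g (L f))"
      by (simp add: strong_operator_topology_continuous_evaluation)
  qed
  have "T \<longlonglongrightarrow> Wstar_op L"
  proof (rule Lim_null[THEN iffD2, OF tendsto_norm_zero_cancel])
    have "norm (T n - Wstar_op L) = norm (blinfun_of_wstar (T n) - L)" for n
      using norm_diff[of "T n" "Wstar_op L"] cont by (simp add: Wstar_op_inverse)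
    then show "(\<lambda>n. norm (T n - Wstar_op L)) \<longlonglongrightarrow> 0"
      using tendsto_norm_zero[OF Lim_null[THEN iffD1, OF L]] by simp
  qed
  then show "convergent T" by (rule convergentI)
qed


section \<open>The space of weakly 1-summable sequences\<close>

typedef (overloaded) 'a weak_l1 = "{z :: nat \<Rightarrow> 'a::real_normed_vector. weakly_summable 1 z}"
  morphisms weak_l1_nth Weak_l1
  by (rule exI[of _ "\<lambda>_. 0"]) (simp add: weakly_summable_def)

setup_lifting type_definition_weak_l1

lemma weakly_summable_1_iff:
  "weakly_summable 1 z \<longleftrightarrow> (\<forall>f :: 'a::real_normed_vector \<Rightarrow>\<^sub>L real. summable (\<lambda>n. \<bar>blinfun_apply f (z n)\<bar>))"
  by (simp add: weakly_summable_def)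

lemma weakly_summable_1_bound:
  fixes z :: "nat \<Rightarrow> 'a::real_normed_vector"
  assumes z: "weakly_summable 1 z"
  obtains C where "\<And>f :: 'a \<Rightarrow>\<^sub>L real. norm f \<le> 1 \<Longrightarrow> (\<Sum>n. \<bar>blinfun_apply f (z n)\<bar>) \<le> C"
proof -
  define A where "A = (\<lambda>k::nat. {f :: 'a \<Rightarrow>\<^sub>L real. \<forall>N. (\<Sum>n<N. \<bar>blinfun_apply f (z n)\<bar>) \<le> real k})"
  have sum: "summable (\<lambda>n. \<bar>blinfun_apply f (z n)\<bar>)" for f :: "'a \<Rightarrow>\<^sub>L real"
    using z by (simp add: weakly_summable_1_iff)
  have closed: "closed (A k)" for k
    unfolding A_def by (intro closed_Collect_all closed_Collect_le continuous_intros)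
  have "\<exists>k. f \<in> A k" for f
  proof -
    obtain k where k: "(\<Sum>n. \<bar>blinfun_apply f (z n)\<bar>) \<le> real k" using real_arch_simple by blast
    have "(\<Sum>n<N. \<bar>blinfun_apply f (z n)\<bar>) \<le> (\<Sum>n. \<bar>blinfun_apply f (z n)\<bar>)" for N
      by (rule sum_le_suminf[OF sum]) auto
    then have "f \<in> A k" using k unfolding A_def by (auto intro: order.trans)
    then show ?thesis ..
  qed
  then have "\<Union>(range A) = UNIV" by blast
  moreover have "interior (\<Union>(range A)) = {}" if "\<And>k. interior (A k) = {}"
    using Met_TC.metric_Baire_category_alt[where \<G> = "range A"] that closed
    by (auto simp: complete_UNIV)
  ultimately obtain k where "interior (A k) \<noteq> {}"
    by (metis UNIV_not_empty interior_UNIV)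
  then obtain f0 r where r: "r > 0" "ball f0 r \<subseteq> A k"
    by (metis all_not_in_conv mem_interior)
  have "(\<Sum>n. \<bar>blinfun_apply g (z n)\<bar>) \<le> 4 * real k / r" if g: "norm g \<le> 1" for g :: "'a \<Rightarrow>\<^sub>L real"
  proof (rule suminf_le_const[OF sum])
    fix N
    have "f0 \<in> A k" using r by auto
    moreover have "f0 + (r / 2) *\<^sub>R g \<in> A k"
    proof -
      have "norm ((r / 2) *\<^sub>R g) < r"
        using r g mult_left_le[of "norm g" "r / 2"] by simp
      then show ?thesis using r(2) by (auto simp: dist_norm norm_minus_commute)
    qed
    ultimately have "(\<Sum>n<N. \<bar>(f0 + (r / 2) *\<^sub>R g) (z n)\<bar>) + (\<Sum>n<N. \<bar>f0 (z n)\<bar>) \<le> 2 * real k"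
      unfolding A_def by (fastforce intro: add_mono[of _ "real k" _ "real k", simplified])
    moreover have "(\<Sum>n<N. (r / 2) * \<bar>blinfun_apply g (z n)\<bar>)
        \<le> (\<Sum>n<N. \<bar>(f0 + (r / 2) *\<^sub>R g) (z n)\<bar> + \<bar>f0 (z n)\<bar>)"
    proof (rule sum_mono)
      fix n
      have "(r / 2) * \<bar>blinfun_apply g (z n)\<bar> = \<bar>(r / 2) * blinfun_apply g (z n)\<bar>" using r by (simp add: abs_mult)
      then show "(r / 2) * \<bar>blinfun_apply g (z n)\<bar> \<le> \<bar>(f0 + (r / 2) *\<^sub>R g) (z n)\<bar> + \<bar>f0 (z n)\<bar>"
        unfolding blinfun.add_left blinfun.scaleR_left real_scaleR_def by linarith
    qed
    ultimately have "(r / 2) * (\<Sum>n<N. \<bar>blinfun_apply g (z n)\<bar>) \<le> 2 * real k"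
      by (simp add: sum_distrib_left sum.distrib)
    then show "(\<Sum>n<N. \<bar>blinfun_apply g (z n)\<bar>) \<le> 4 * real k / r" using r by (simp add: field_simps)
  qed
  then show ?thesis by (rule that)
qed

instantiation weak_l1 :: (real_normed_vector) real_vector
begin

lift_definition zero_weak_l1 :: "'a weak_l1" is "\<lambda>_. 0"
  by (simp add: weakly_summable_1_iff)

lift_definition plus_weak_l1 :: "'a weak_l1 \<Rightarrow> 'a weak_l1 \<Rightarrow> 'a weak_l1" is "\<lambda>y z n. y n + z n"
  unfolding weakly_summable_1_iff
proof
  fix y z :: "nat \<Rightarrow> 'a" and f :: "'a \<Rightarrow>\<^sub>L real"
  assume "\<forall>f :: 'a \<Rightarrow>\<^sub>L real. summable (\<lambda>n. \<bar>blinfun_apply f (y n)\<bar>)" "\<forall>f :: 'a \<Rightarrow>\<^sub>L real. summable (\<lambda>n. \<bar>blinfun_apply f (z n)\<bar>)"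
  then have "summable (\<lambda>n. \<bar>blinfun_apply f (y n)\<bar> + \<bar>blinfun_apply f (z n)\<bar>)" by (intro summable_add) auto
  then show "summable (\<lambda>n. \<bar>blinfun_apply f (y n + z n)\<bar>)"
    by (rule summable_comparison_test'[where N = 0]) (simp add: blinfun.bilinear_simps)
qed

lift_definition uminus_weak_l1 :: "'a weak_l1 \<Rightarrow> 'a weak_l1" is "\<lambda>z n. - z n"
  unfolding weakly_summable_1_iff blinfun.minus_right abs_minus_cancel .

lift_definition scaleR_weak_l1 :: "real \<Rightarrow> 'a weak_l1 \<Rightarrow> 'a weak_l1" is "\<lambda>a z n. a *\<^sub>R z n"
  unfolding weakly_summable_1_iff blinfun.scaleR_right real_scaleR_def abs_mult
  by (rule allI, rule summable_mult) blast

definition minus_weak_l1 :: "'a weak_l1 \<Rightarrow> 'a weak_l1 \<Rightarrow> 'a weak_l1"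
  where "minus_weak_l1 y z = y + - z"

instance
proof
  fix x y z :: "'a weak_l1" and a b :: real
  show "x + y + z = x + (y + z)" by transfer (simp add: add.assoc)
  show "x + y = y + x" by transfer (simp add: add.commute)
  show "0 + x = x" by transfer simp
  show "- x + x = 0" by transfer simp
  show "x - y = x + - y" by (rule minus_weak_l1_def)
  show "a *\<^sub>R (x + y) = a *\<^sub>R x + a *\<^sub>R y" by transfer (simp add: scaleR_add_right)
  show "(a + b) *\<^sub>R x = a *\<^sub>R x + b *\<^sub>R x" by transfer (simp add: scaleR_add_left)
  show "a *\<^sub>R b *\<^sub>R x = (a * b) *\<^sub>R x" by transfer simp
  show "1 *\<^sub>R x = x" by transfer simp
qed

end

lemma weak_l1_nth_diff: "weak_l1_nth (y - z) n = weak_l1_nth y n - weak_l1_nth z n"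
  unfolding minus_weak_l1_def plus_weak_l1.rep_eq uminus_weak_l1.rep_eq by simp

lemma summable_weak_l1_nth: "summable (\<lambda>n. \<bar>blinfun_apply (f :: 'a::real_normed_vector \<Rightarrow>\<^sub>L real) (weak_l1_nth z n)\<bar>)"
  using weak_l1_nth[of z] by (simp add: weakly_summable_1_iff)

definition weak_l1_norm :: "(nat \<Rightarrow> 'a::real_normed_vector) \<Rightarrow> real" where
  "weak_l1_norm z = (SUP f \<in> {f :: 'a \<Rightarrow>\<^sub>L real. norm f \<le> 1}. \<Sum>n. \<bar>blinfun_apply f (z n)\<bar>)"

lemma weak_l1_norm_upper:
  fixes z :: "'a::real_normed_vector weak_l1" and f :: "'a \<Rightarrow>\<^sub>L real"
  assumes "norm f \<le> 1"
  shows "(\<Sum>n. \<bar>blinfun_apply f (weak_l1_nth z n)\<bar>) \<le> weak_l1_norm (weak_l1_nth z)"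
proof -
  obtain C where "\<And>f :: 'a \<Rightarrow>\<^sub>L real. norm f \<le> 1 \<Longrightarrow> (\<Sum>n. \<bar>blinfun_apply f (weak_l1_nth z n)\<bar>) \<le> C"
    using weakly_summable_1_bound weak_l1_nth by (metis mem_Collect_eq)
  then have "bdd_above ((\<lambda>f :: 'a \<Rightarrow>\<^sub>L real. \<Sum>n. \<bar>blinfun_apply f (weak_l1_nth z n)\<bar>) ` {f. norm f \<le> 1})"
    by (intro bdd_aboveI2) auto
  then show ?thesis unfolding weak_l1_norm_def using assms by (intro cSUP_upper) auto
qed

lemma weak_l1_norm_least:
  fixes z :: "nat \<Rightarrow> 'a::real_normed_vector"
  assumes "\<And>f :: 'a \<Rightarrow>\<^sub>L real. norm f \<le> 1 \<Longrightarrow> (\<Sum>n. \<bar>blinfun_apply f (z n)\<bar>) \<le> C"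
  shows "weak_l1_norm z \<le> C"
  unfolding weak_l1_norm_def using assms
  by (intro cSUP_least) (auto intro: exI[of _ 0])

lemma norm_nth_le_weak_l1_norm:
  "norm (weak_l1_nth z n) \<le> weak_l1_norm (weak_l1_nth (z :: 'a::real_normed_vector weak_l1))"
proof -
  obtain f :: "'a \<Rightarrow>\<^sub>L real" where f: "norm f \<le> 1" "blinfun_apply f (weak_l1_nth z n) = norm (weak_l1_nth z n)"
    by (rule norming_functional)
  have "\<bar>f (weak_l1_nth z n)\<bar> \<le> (\<Sum>n. \<bar>blinfun_apply f (weak_l1_nth z n)\<bar>)"
    using sum_le_suminf[OF summable_weak_l1_nth, of "{n}" f z] by simp
  then show ?thesis using weak_l1_norm_upper[OF f(1), of z] f(2) by simp
qed

instantiation weak_l1 :: (real_normed_vector) real_normed_vector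
begin

definition norm_weak_l1 :: "'a weak_l1 \<Rightarrow> real"
  where "norm_weak_l1 z = weak_l1_norm (weak_l1_nth z)"

definition dist_weak_l1 :: "'a weak_l1 \<Rightarrow> 'a weak_l1 \<Rightarrow> real"
  where "dist_weak_l1 y z = norm (y - z)"

definition sgn_weak_l1 :: "'a weak_l1 \<Rightarrow> 'a weak_l1"
  where "sgn_weak_l1 z = inverse (norm z) *\<^sub>R z"

definition uniformity_weak_l1 :: "('a weak_l1 \<times> 'a weak_l1) filter"
  where "uniformity_weak_l1 = (INF e\<in>{0 <..}. principal {(x, y). dist x y < e})"

definition open_weak_l1 :: "'a weak_l1 set \<Rightarrow> bool"
  where "open_weak_l1 S = (\<forall>x\<in>S. \<forall>\<^sub>F (x', y) in uniformity. x' = x \<longrightarrow> y \<in> S)"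

instance
proof
  fix y z :: "'a weak_l1" and a :: real
  have scale_le: "norm (a *\<^sub>R z) \<le> \<bar>a\<bar> * norm z" for a and z :: "'a weak_l1"
    unfolding norm_weak_l1_def
  proof (rule weak_l1_norm_least)
    fix f :: "'a \<Rightarrow>\<^sub>L real" assume f: "norm f \<le> 1"
    have "(\<Sum>n. \<bar>blinfun_apply f (weak_l1_nth (a *\<^sub>R z) n)\<bar>) = \<bar>a\<bar> * (\<Sum>n. \<bar>blinfun_apply f (weak_l1_nth z n)\<bar>)"
      by (simp add: scaleR_weak_l1.rep_eq blinfun.bilinear_simps abs_mult
          suminf_mult[OF summable_weak_l1_nth])
    also have "\<dots> \<le> \<bar>a\<bar> * weak_l1_norm (weak_l1_nth z)"
      by (intro mult_left_mono weak_l1_norm_upper f) auto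
    finally show "(\<Sum>n. \<bar>blinfun_apply f (weak_l1_nth (a *\<^sub>R z) n)\<bar>) \<le> \<bar>a\<bar> * weak_l1_norm (weak_l1_nth z)" .
  qed
  show "norm z = 0 \<longleftrightarrow> z = 0"
  proof
    assume "norm z = 0"
    then have "weak_l1_nth z n = 0" for n
      using norm_nth_le_weak_l1_norm[of z n] by (simp add: norm_weak_l1_def)
    then show "z = 0"
      by (simp add: weak_l1_nth_inject[symmetric] zero_weak_l1.rep_eq fun_eq_iff)
  next
    assume "z = 0"
    then show "norm z = 0" using scale_le[of 0 z] norm_nth_le_weak_l1_norm[of z 0]
      by (simp add: norm_weak_l1_def zero_weak_l1.rep_eq)
  qed
  show "norm (y + z) \<le> norm y + norm z"
    unfolding norm_weak_l1_def
  proof (rule weak_l1_norm_least)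
    fix f :: "'a \<Rightarrow>\<^sub>L real" assume f: "norm f \<le> 1"
    have "(\<Sum>n. \<bar>blinfun_apply f (weak_l1_nth (y + z) n)\<bar>)
        \<le> (\<Sum>n. \<bar>blinfun_apply f (weak_l1_nth y n)\<bar> + \<bar>blinfun_apply f (weak_l1_nth z n)\<bar>)"
      by (intro suminf_le summable_weak_l1_nth summable_add)
        (simp add: plus_weak_l1.rep_eq blinfun.bilinear_simps)
    also have "\<dots> = (\<Sum>n. \<bar>blinfun_apply f (weak_l1_nth y n)\<bar>) + (\<Sum>n. \<bar>blinfun_apply f (weak_l1_nth z n)\<bar>)"
      by (rule suminf_add[symmetric]) (rule summable_weak_l1_nth)+
    also have "\<dots> \<le> weak_l1_norm (weak_l1_nth y) + weak_l1_norm (weak_l1_nth z)"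
      by (intro add_mono weak_l1_norm_upper f)
    finally show "(\<Sum>n. \<bar>blinfun_apply f (weak_l1_nth (y + z) n)\<bar>)
      \<le> weak_l1_norm (weak_l1_nth y) + weak_l1_norm (weak_l1_nth z)" .
  qed
  show "norm (a *\<^sub>R z) = \<bar>a\<bar> * norm z"
  proof (cases "a = 0")
    case True
    then show ?thesis using scale_le[of 0 z] norm_nth_le_weak_l1_norm[of "0 *\<^sub>R z" 0]
      by (simp add: norm_weak_l1_def zero_weak_l1.rep_eq)
  next
    case False
    have "norm (inverse a *\<^sub>R (a *\<^sub>R z)) \<le> \<bar>inverse a\<bar> * norm (a *\<^sub>R z)" by (rule scale_le)
    then have "\<bar>a\<bar> * norm z \<le> norm (a *\<^sub>R z)" using False by (simp add: field_simps abs_inverse)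
    then show ?thesis using scale_le[of a z] by simp
  qed
qed (rule dist_weak_l1_def sgn_weak_l1_def uniformity_weak_l1_def open_weak_l1_def)+

end

instance weak_l1 :: (banach) banach
proof
  fix Z :: "nat \<Rightarrow> 'a weak_l1"
  assume Cau: "Cauchy Z"
  have nth_le: "norm (weak_l1_nth (Z k) n - weak_l1_nth (Z m) n) \<le> norm (Z k - Z m)" for k m n
    using norm_nth_le_weak_l1_norm[of "Z k - Z m" n] by (simp add: weak_l1_nth_diff norm_weak_l1_def)
  have "Cauchy (\<lambda>k. weak_l1_nth (Z k) n)" for n
  proof (rule CauchyI)
    fix e :: real assume "e > 0"
    from CauchyD[OF Cau this] show "\<exists>M. \<forall>m\<ge>M. \<forall>k\<ge>M. norm (weak_l1_nth (Z m) n - weak_l1_nth (Z k) n) < e"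
      by (meson nth_le le_less_trans)
  qed
  then have "\<exists>l. (\<lambda>k. weak_l1_nth (Z k) n) \<longlonglongrightarrow> l" for n
    by (auto simp: Cauchy_convergent_iff convergent_def)
  then obtain z where z: "\<And>n. (\<lambda>k. weak_l1_nth (Z k) n) \<longlonglongrightarrow> z n" by metis
  have key: "\<exists>K. \<forall>k\<ge>K. \<forall>f :: 'a \<Rightarrow>\<^sub>L real. norm f \<le> 1 \<longrightarrow>
      (\<forall>N. (\<Sum>n<N. \<bar>blinfun_apply f (weak_l1_nth (Z k) n - z n)\<bar>) \<le> e)" if e: "e > 0" for e
  proof -
    obtain K where K: "\<And>k m. k \<ge> K \<Longrightarrow> m \<ge> K \<Longrightarrow> norm (Z k - Z m) < e"
      using CauchyD[OF Cau e] by blast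
    have "(\<Sum>n<N. \<bar>blinfun_apply f (weak_l1_nth (Z k) n - z n)\<bar>) \<le> e"
      if k: "k \<ge> K" and f: "norm f \<le> 1" for k N and f :: "'a \<Rightarrow>\<^sub>L real"
    proof (rule LIMSEQ_le_const2)
      show "(\<lambda>m. \<Sum>n<N. \<bar>blinfun_apply f (weak_l1_nth (Z k) n - weak_l1_nth (Z m) n)\<bar>)
          \<longlonglongrightarrow> (\<Sum>n<N. \<bar>blinfun_apply f (weak_l1_nth (Z k) n - z n)\<bar>)"
        by (intro tendsto_intros z)
      have "(\<Sum>n<N. \<bar>blinfun_apply f (weak_l1_nth (Z k) n - weak_l1_nth (Z m) n)\<bar>) \<le> e" if "m \<ge> K" for m
      proof -
        have "(\<Sum>n<N. \<bar>blinfun_apply f (weak_l1_nth (Z k - Z m) n)\<bar>) \<le> (\<Sum>n. \<bar>blinfun_apply f (weak_l1_nth (Z k - Z m) n)\<bar>)"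
          by (rule sum_le_suminf[OF summable_weak_l1_nth]) auto
        also have "\<dots> \<le> norm (Z k - Z m)"
          unfolding norm_weak_l1_def by (rule weak_l1_norm_upper[OF f])
        also have "\<dots> \<le> e" using K[OF k that] by simp
        finally show ?thesis by (simp add: weak_l1_nth_diff)
      qed
      then show "\<exists>M. \<forall>m\<ge>M. (\<Sum>n<N. \<bar>blinfun_apply f (weak_l1_nth (Z k) n - weak_l1_nth (Z m) n)\<bar>) \<le> e"
        by blast
    qed
    then show ?thesis by blast
  qed
  have "weakly_summable 1 z"
    unfolding weakly_summable_1_iff
  proof
    fix f :: "'a \<Rightarrow>\<^sub>L real"
    obtain k where k: "\<And>f :: 'a \<Rightarrow>\<^sub>L real. \<And>N. norm f \<le> 1 \<Longrightarrow> (\<Sum>n<N. \<bar>blinfun_apply f (weak_l1_nth (Z k) n - z n)\<bar>) \<le> 1"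
      using key[of 1] by force
    define g where "g = f /\<^sub>R (norm f + 1)"
    have pos: "norm f + 1 > 0" by (simp add: add_nonneg_pos)
    have "norm g = norm f / (norm f + 1)" using pos by (simp add: g_def field_simps)
    then have g: "norm g \<le> 1" using pos by simp
    have "summable (\<lambda>n. \<bar>blinfun_apply g (weak_l1_nth (Z k) n - z n)\<bar>)"
      by (rule bounded_imp_summable[where B = 1])
        (simp_all only: lessThan_Suc_atMost[symmetric] k[OF g] abs_ge_zero)
    then have "summable (\<lambda>n. \<bar>blinfun_apply g (weak_l1_nth (Z k) n)\<bar> + \<bar>blinfun_apply g (weak_l1_nth (Z k) n - z n)\<bar>)"
      by (intro summable_add summable_weak_l1_nth)
    then have "summable (\<lambda>n. \<bar>blinfun_apply g (z n)\<bar>)"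
      by (rule summable_comparison_test'[where N = 0]) (simp add: blinfun.bilinear_simps)
    then have "summable (\<lambda>n. (norm f + 1) * \<bar>blinfun_apply g (z n)\<bar>)" by (rule summable_mult)
    moreover have "(norm f + 1) * \<bar>blinfun_apply g (z n)\<bar> = \<bar>blinfun_apply f (z n)\<bar>" for n
      using pos by (simp add: g_def blinfun.bilinear_simps abs_mult)
    ultimately show "summable (\<lambda>n. \<bar>blinfun_apply f (z n)\<bar>)" by simp
  qed
  then have nth: "weak_l1_nth (Weak_l1 z) = z" by (simp add: Weak_l1_inverse)
  have "Z \<longlonglongrightarrow> Weak_l1 z"
  proof (rule LIMSEQ_I)
    fix e :: real assume "e > 0"
    then obtain K where K: "\<forall>k\<ge>K. \<forall>f :: 'a \<Rightarrow>\<^sub>L real. norm f \<le> 1 \<longrightarrow>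
        (\<forall>N. (\<Sum>n<N. \<bar>blinfun_apply f (weak_l1_nth (Z k) n - z n)\<bar>) \<le> e / 2)"
      using key[of "e / 2"] half_gt_zero by blast
    have "norm (Z k - Weak_l1 z) < e" if "k \<ge> K" for k
    proof -
      have "norm (Z k - Weak_l1 z) \<le> e / 2"
        unfolding norm_weak_l1_def
        using K that
        by (intro weak_l1_norm_least suminf_le_const summable_weak_l1_nth)
          (auto simp: weak_l1_nth_diff nth)
      then show ?thesis using \<open>e > 0\<close> by simp
    qed
    then show "\<exists>K. \<forall>k\<ge>K. norm (Z k - Weak_l1 z) < e" by blast
  qed
  then show "convergent Z" by (rule convergentI)
qed

end

theory Submission
  imports Defs
begin

text \<open>
  Call a sequence \<open>u\<close> in \<open>E\<close> admissible if it is weakly \<open>p\<close>-summable and its terms form a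
  Dunford-Pettis set. Bounded operators map admissible sequences to admissible ones, so an
  operator from \<open>E\<close> into a space with the \<open>p\<close>-(DPrcP) maps them to norm null sequences
  (\<open>DPrcP_image_null\<close>).

  In each of the three cases the elements of \<open>E\<close> act on a unit ball with values in a space \<open>Y\<close>
  with the Schur property, and the norm of \<open>E\<close> is the supremum of the norms of these values. Let
  \<open>u\<close> be admissible and choose for each \<open>n\<close> a point \<open>x\<^sub>n\<close> of the ball at which \<open>u\<^sub>n\<close> attains
  at least half of its norm. For a fixed functional \<open>g\<close> on \<open>Y\<close>, composition with \<open>g\<close> is a bounded operator from
  \<open>E\<close> into the space that has the \<open>p\<close>-(DPrcP) by hypothesis; hence \<open>g \<circ> u\<^sub>n\<close> tends to \<open>0\<close>
  uniformly on the ball, and in particular \<open>g (u\<^sub>n x\<^sub>n)\<close> tends to \<open>0\<close>. So \<open>u\<^sub>n x\<^sub>n\<close> is weakly null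
  in \<open>Y\<close>, and by the Schur property \<open>\<parallel>u\<^sub>n x\<^sub>n\<parallel>\<close>, and with it \<open>\<parallel>u\<^sub>n\<parallel>\<close>, tends to \<open>0\<close>.

  For \<open>L(X,Y)\<close>, composition with \<open>g\<close> lands in \<open>X\<^sup>*\<close>. For \<open>L\<^sub>w\<^sub>*(X\<^sup>*,Y)\<close> it gives weak-star
  continuous functionals on \<open>X\<^sup>*\<close>, that is, elements of \<open>X\<close>. A sequence in \<open>\<ell>\<^sub>1\<^sup>w(X\<^sup>*)\<close> acts on \<open>X\<close>
  with values in \<open>\<ell>\<^sub>1\<close> by \<open>x \<mapsto> (z\<^sub>n x)\<^sub>n\<close>; a functional on \<open>\<ell>\<^sub>1\<close> is a bounded sequence \<open>s\<close>, and
  composition with it is \<open>\<Sum>n. s\<^sub>n z\<^sub>n \<in> X\<^sup>*\<close>. Here the Schur property is that of \<open>\<ell>\<^sub>1\<close>, which is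
  proved for plain real sequences (\<open>l1_schur\<close>).
\<close>

section \<open>Operators into spaces with the p-(DPrcP)\<close>

lemma weakly_summable_image:
  fixes A :: "'a::real_normed_vector \<Rightarrow>\<^sub>L 'b::real_normed_vector"
  assumes "weakly_summable p x"
  shows "weakly_summable p (\<lambda>n. A (x n))"
  unfolding weakly_summable_def
proof
  fix f :: "'b \<Rightarrow>\<^sub>L real"
  show "summable (\<lambda>n. \<bar>f (A (x n))\<bar> powr p)"
    using assms[unfolded weakly_summable_def, rule_format, of "f o\<^sub>L A"] by simp
qed

text \<open>The adjoint of \<open>A\<close> maps weakly null sequences of functionals to weakly null ones.\<close>

lemma dunford_pettis_set_image:
  fixes A :: "'a::real_normed_vector \<Rightarrow>\<^sub>L 'b::real_normed_vector"
  assumes K: "dunford_pettis_set K"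
  shows "dunford_pettis_set (A ` K)"
  unfolding dunford_pettis_set_def
proof (intro conjI allI impI)
  show "bounded (A ` K)"
    using K by (auto simp: dunford_pettis_set_def intro: bounded_linear_image blinfun.bounded_linear_right)
  fix f :: "nat \<Rightarrow> 'b \<Rightarrow>\<^sub>L real"
  assume f: "weakly_null f"
  have "weakly_null (\<lambda>n. f n o\<^sub>L A)"
    unfolding weakly_null_def
  proof
    fix h :: "('a \<Rightarrow>\<^sub>L real) \<Rightarrow>\<^sub>L real"
    have bl: "bounded_linear (\<lambda>g :: 'b \<Rightarrow>\<^sub>L real. h (g o\<^sub>L A))"
      by (intro bounded_linear_compose[OF blinfun.bounded_linear_right]
          bounded_bilinear.bounded_linear_left[OF bounded_bilinear_blinfun_compose])
    show "(\<lambda>n. h (f n o\<^sub>L A)) \<longlonglongrightarrow> 0"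
      using f[unfolded weakly_null_def, rule_format, of "Blinfun (\<lambda>g. h (g o\<^sub>L A))"]
      by (simp add: bounded_linear_Blinfun_apply[OF bl])
  qed
  then have "uniform_limit K (\<lambda>n x. (f n o\<^sub>L A) x) (\<lambda>_. 0) sequentially"
    using K unfolding dunford_pettis_set_def by blast
  then show "uniform_limit (A ` K) (\<lambda>n x. blinfun_apply (f n) x) (\<lambda>_. 0) sequentially"
    by (simp add: uniform_limit_iff)
qed

lemma DPrcP_image_null:
  fixes A :: "'a::real_normed_vector \<Rightarrow> 'b::banach"
  assumes "DPrcP p TYPE('b)" "bounded_linear A"
    and "weakly_summable p x" "dunford_pettis_set (range x)"
  shows "(\<lambda>n. A (x n)) \<longlonglongrightarrow> 0"
proof -
  note app = bounded_linear_Blinfun_apply[OF assms(2)]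
  have "weakly_summable p (\<lambda>n. A (x n))"
    using weakly_summable_image[OF assms(3), of "Blinfun A"] by (simp add: app)
  moreover have "dunford_pettis_set (range (\<lambda>n. A (x n)))"
    using dunford_pettis_set_image[OF assms(4), of "Blinfun A"] by (simp add: app image_image)
  ultimately show ?thesis using assms(1) unfolding DPrcP_def by blast
qed


section \<open>Norms that are suprema over a unit ball\<close>

text \<open>Evaluating each \<open>u n\<close> at a point where it reaches half of its norm turns convergence
  along sequences of points into uniform convergence.\<close>

lemma null_if_null_along_unit_ball:
  fixes u :: "nat \<Rightarrow> 'e::real_normed_vector" and \<phi> :: "nat \<Rightarrow> 'x::real_normed_vector \<Rightarrow> real"
  assumes sup: "\<And>n C. (\<And>x. norm x \<le> 1 \<Longrightarrow> \<phi> n x \<le> C) \<Longrightarrow> norm (u n) \<le> C"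
    and pos: "\<And>n x. 0 \<le> \<phi> n x"
    and null: "\<And>x. (\<And>n. norm (x n) \<le> 1) \<Longrightarrow> (\<lambda>n. \<phi> n (x n)) \<longlonglongrightarrow> 0"
  shows "u \<longlonglongrightarrow> 0"
proof -
  have "\<exists>x. norm x \<le> 1 \<and> norm (u n) \<le> 2 * \<phi> n x" for n
  proof (rule ccontr)
    assume "\<nexists>x. norm x \<le> 1 \<and> norm (u n) \<le> 2 * \<phi> n x"
    then have *: "2 * \<phi> n x < norm (u n)" if "norm x \<le> 1" for x
      using that by force
    have "norm (u n) \<le> norm (u n) / 2"
      by (rule sup) (use * in force)
    moreover have "0 < norm (u n)" using *[of 0] pos[of n 0] unfolding norm_zero by linarith
    ultimately show False by simp
  qed
  then obtain x where x: "\<And>n. norm (x n) \<le> 1" "\<And>n. norm (u n) \<le> 2 * \<phi> n (x n)" by metis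
  have "(\<lambda>n. 2 * \<phi> n (x n)) \<longlonglongrightarrow> 0"
    using tendsto_mult_right_zero[OF null[OF x(1)]] .
  then show ?thesis
    by (rule Lim_null_comparison[rotated]) (use x(2) in simp)
qed

lemma norm_blinfun_le_unit_ball:
  fixes T :: "'x::real_normed_vector \<Rightarrow>\<^sub>L 'y::real_normed_vector"
  assumes "\<And>x. norm x \<le> 1 \<Longrightarrow> norm (T x) \<le> C"
  shows "norm T \<le> C"
proof (rule norm_blinfun_bound)
  show "0 \<le> C" using assms[of 0] by simp
  show "norm (T x) \<le> C * norm x" for x
  proof (cases "x = 0")
    case False
    then have "norm (T (x /\<^sub>R norm x)) \<le> C" by (intro assms) simp
    then show ?thesis using False by (simp add: blinfun.scaleR_right field_simps)
  qed simp
qed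

text \<open>The common form of the two statements on spaces of operators: \<open>J\<close> embeds \<open>E\<close> into the
  operators from \<open>Z\<close> to \<open>Y\<close>, and \<open>A g e\<close> stands for the functional \<open>g \<circ> J e\<close>, represented in the
  space \<open>W\<close> that has the \<open>p\<close>-(DPrcP).\<close>

lemma DPrcP_operator_space:
  fixes J :: "'e::banach \<Rightarrow> 'z::real_normed_vector \<Rightarrow>\<^sub>L 'y::banach"
    and A :: "('y \<Rightarrow>\<^sub>L real) \<Rightarrow> 'e \<Rightarrow> 'w::banach"
  assumes W: "DPrcP p TYPE('w)" and Y: "schur_property TYPE('y)"
    and J: "\<And>e. norm (J e) = norm e"
    and A: "\<And>g. bounded_linear (A g)"
    and le: "\<And>g e z. \<bar>blinfun_apply g (J e z)\<bar> \<le> norm (A g e) * norm z"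
  shows "DPrcP p TYPE('e)"
  unfolding DPrcP_def
proof (intro allI impI, elim conjE)
  fix u :: "nat \<Rightarrow> 'e"
  assume u: "weakly_summable p u" "dunford_pettis_set (range u)"
  show "u \<longlonglongrightarrow> 0"
  proof (rule null_if_null_along_unit_ball[where \<phi> = "\<lambda>n z. norm (blinfun_apply (J (u n)) z)"])
    show "norm (u n) \<le> C" if "\<And>z. norm z \<le> 1 \<Longrightarrow> norm (blinfun_apply (J (u n)) z) \<le> C" for n C
      using norm_blinfun_le_unit_ball[OF that] by (simp add: J)
    fix z :: "nat \<Rightarrow> 'z"
    assume z: "\<And>n. norm (z n) \<le> 1"
    have "weakly_null (\<lambda>n. J (u n) (z n))"
      unfolding weakly_null_def
    proof
      fix g :: "'y \<Rightarrow>\<^sub>L real"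
      have null: "(\<lambda>n. norm (A g (u n))) \<longlonglongrightarrow> 0"
        by (intro tendsto_norm_zero DPrcP_image_null[OF W A u])
      have bound: "norm (g (J (u n) (z n))) \<le> norm (A g (u n))" for n
        using le[of g "u n" "z n"] mult_left_le[OF z[of n] norm_ge_zero[of "A g (u n)"]] by simp
      show "(\<lambda>n. g (J (u n) (z n))) \<longlonglongrightarrow> 0"
        by (rule Lim_null_comparison[OF always_eventually[OF allI[OF bound]] null])
    qed
    then show "(\<lambda>n. norm (J (u n) (z n))) \<longlonglongrightarrow> 0"
      using Y unfolding schur_property_def by (intro tendsto_norm_zero) blast
  qed simp
qed

theorem DPrcP_blinfun:
  assumes X: "DPrcP p TYPE('x::banach \<Rightarrow>\<^sub>L real)" and Y: "schur_property TYPE('y::banach)"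
  shows "DPrcP p TYPE('x \<Rightarrow>\<^sub>L 'y)"
proof (rule DPrcP_operator_space[OF X Y, where J = "\<lambda>T. T" and A = "\<lambda>g T. g o\<^sub>L T"])
  show "bounded_linear (\<lambda>T :: 'x \<Rightarrow>\<^sub>L 'y. g o\<^sub>L T)" for g :: "'y \<Rightarrow>\<^sub>L real"
    by (rule bounded_bilinear.bounded_linear_right[OF bounded_bilinear_blinfun_compose])
  show "\<bar>g (T x)\<bar> \<le> norm (g o\<^sub>L T) * norm x" for g :: "'y \<Rightarrow>\<^sub>L real" and T :: "'x \<Rightarrow>\<^sub>L 'y" and x
    using norm_blinfun[of "g o\<^sub>L T" x] by simp
qed (rule refl)


section \<open>Weak-star to weak continuous operators\<close>

text \<open>\<open>A T\<close> is the image of \<open>g\<close> under the pre-adjoint of \<open>T\<close>. It exists because a weak-star continuous functional on \<open>X\<^sup>*\<close> is evaluation at a point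
  of \<open>X\<close>.\<close>

lemma wstar_op_preadjoint:
  fixes g :: "'y::real_normed_vector \<Rightarrow>\<^sub>L real"
  obtains A :: "('x::real_normed_vector, 'y) wstar_op \<Rightarrow> 'x"
  where "bounded_linear A" "\<And>T f. g (blinfun_of_wstar T f) = blinfun_apply f (A T)"
proof -
  have "\<exists>x. \<forall>f. g (blinfun_of_wstar T f) = blinfun_apply f x" for T :: "('x, 'y) wstar_op"
  proof (rule weak_star_continuous_imp_evaluation)
    show "linear (\<lambda>f. g (blinfun_of_wstar T f))"
      by (rule linearI) (simp_all add: blinfun.bilinear_simps)
    show "continuous_map weak_star_topology euclideanreal (\<lambda>f. g (blinfun_of_wstar T f))"
      using blinfun_of_wstar[of T] by (simp add: continuous_map_weak_topology_iff)
  qed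
  then obtain A :: "('x, 'y) wstar_op \<Rightarrow> 'x"
    where A: "\<And>T f. g (blinfun_of_wstar T f) = blinfun_apply f (A T)" by metis
  have point_eqI: "x = y" if "\<And>f :: 'x \<Rightarrow>\<^sub>L real. f x = f y" for x y
  proof -
    obtain f :: "'x \<Rightarrow>\<^sub>L real" where "f (x - y) = norm (x - y)"
      by (rule norming_functional)
    then show ?thesis using that[of f] by (simp add: blinfun.diff_right)
  qed
  have "bounded_linear A"
  proof (rule bounded_linear_intro[where K = "norm g"])
    fix S T :: "('x, 'y) wstar_op" and r :: real
    show "A (S + T) = A S + A T"
      by (rule point_eqI) (simp add: A[symmetric] blinfun.bilinear_simps plus_wstar_op.rep_eq)
    show "A (r *\<^sub>R T) = r *\<^sub>R A T"
      by (rule point_eqI) (simp add: A[symmetric] blinfun.bilinear_simps scaleR_wstar_op.rep_eq)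
    obtain f :: "'x \<Rightarrow>\<^sub>L real" where f: "norm f \<le> 1" "f (A T) = norm (A T)"
      by (rule norming_functional)
    have "norm (A T) = g (blinfun_of_wstar T f)" using f(2) by (simp add: A)
    also have "\<dots> \<le> norm g * norm (blinfun_of_wstar T f)"
      using norm_blinfun[of g "blinfun_of_wstar T f"] by simp
    also have "\<dots> \<le> norm g * (norm (blinfun_of_wstar T) * 1)"
      using f(1) by (intro mult_left_mono order.trans[OF norm_blinfun]) auto
    finally show "norm (A T) \<le> norm T * norm g"
      by (simp add: norm_wstar_op.rep_eq mult.commute)
  qed
  then show ?thesis using A by (rule that)
qed

theorem DPrcP_wstar_op:
  assumes X: "DPrcP p TYPE('x::banach)" and Y: "schur_property TYPE('y::banach)"
  shows "DPrcP p TYPE(('x, 'y) wstar_op)"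
proof -
  have "\<exists>A :: ('x, 'y) wstar_op \<Rightarrow> 'x. bounded_linear A \<and>
      (\<forall>T f. g (blinfun_of_wstar T f) = blinfun_apply f (A T))" for g :: "'y \<Rightarrow>\<^sub>L real"
    by (rule wstar_op_preadjoint[of g]) blast
  then obtain A :: "('y \<Rightarrow>\<^sub>L real) \<Rightarrow> ('x, 'y) wstar_op \<Rightarrow> 'x" where A: "\<And>g. bounded_linear (A g)"
    "\<And>g T f. blinfun_apply g (blinfun_of_wstar T f) = blinfun_apply f (A g T)"
    by metis
  show ?thesis
  proof (rule DPrcP_operator_space[OF X Y, where J = blinfun_of_wstar and A = A])
    fix T :: "('x, 'y) wstar_op" and g :: "'y \<Rightarrow>\<^sub>L real" and f :: "'x \<Rightarrow>\<^sub>L real"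
    show "norm (blinfun_of_wstar T) = norm T" by (simp add: norm_wstar_op.rep_eq)
    show "\<bar>g (blinfun_of_wstar T f)\<bar> \<le> norm (A g T) * norm f"
      using norm_blinfun[of f "A g T"] by (simp add: A(2) mult.commute)
  qed (rule A(1))
qed


section \<open>The Schur property of \<open>\<ell>\<^sub>1\<close>\<close>

lemma summable_bounded_mult:
  fixes a s :: "nat \<Rightarrow> real"
  assumes "summable (\<lambda>n. \<bar>a n\<bar>)" "\<And>n. \<bar>s n\<bar> \<le> 1"
  shows "summable (\<lambda>n. s n * a n)" "\<bar>\<Sum>n. s n * a n\<bar> \<le> (\<Sum>n. \<bar>a n\<bar>)"
proof -
  have le: "\<bar>s n * a n\<bar> \<le> \<bar>a n\<bar>" for n
    using mult_right_mono[OF assms(2), of "\<bar>a n\<bar>" n] by (simp add: abs_mult)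
  have abs: "summable (\<lambda>n. \<bar>s n * a n\<bar>)"
    by (rule summable_comparison_test'[OF assms(1), where N = 0]) (simp add: le)
  then show "summable (\<lambda>n. s n * a n)" by (rule summable_rabs_cancel)
  show "\<bar>\<Sum>n. s n * a n\<bar> \<le> (\<Sum>n. \<bar>a n\<bar>)"
    by (rule order.trans[OF summable_rabs[OF abs] suminf_le[OF le abs assms(1)]])
qed

text \<open>Two multipliers that agree on a long initial segment have almost the same value on \<open>a\<close>,
  because the tail of \<open>a\<close> is small.\<close>

lemma l1_pairing_strict_bound_stable:
  fixes a s :: "nat \<Rightarrow> real"
  assumes a: "summable (\<lambda>n. \<bar>a n\<bar>)" and s: "\<And>n. \<bar>s n\<bar> \<le> 1" and big: "\<bar>\<Sum>n. s n * a n\<bar> > e"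
  obtains N where "N \<ge> M"
    "\<forall>t. (\<forall>n. \<bar>t n\<bar> \<le> 1) \<and> (\<forall>n<N. t n = s n) \<longrightarrow> \<bar>\<Sum>n. t n * a n\<bar> > e"
proof -
  define d where "d = \<bar>\<Sum>n. s n * a n\<bar> - e"
  have "d > 0" using big by (simp add: d_def)
  then obtain N0 where N0: "\<And>n. n \<ge> N0 \<Longrightarrow> norm (\<Sum>i. \<bar>a (i + n)\<bar>) < d / 2"
    using suminf_exist_split[OF _ a, of "d / 2"] by auto
  define N where "N = max N0 M"
  have tail: "(\<Sum>i. \<bar>a (i + N)\<bar>) < d / 2" using N0[of N] by (simp add: N_def)
  have aN: "summable (\<lambda>i. \<bar>a (i + N)\<bar>)" using summable_ignore_initial_segment[OF a] .
  have split: "(\<Sum>n. t n * a n) = (\<Sum>n. t (n + N) * a (n + N)) + (\<Sum>n<N. t n * a n)"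
    if "\<And>n. \<bar>t n\<bar> \<le> 1" for t
    by (rule suminf_split_initial_segment[OF summable_bounded_mult(1)[of a t, OF a that]])
  show ?thesis
  proof (rule that[of N])
    show "N \<ge> M" by (simp add: N_def)
    have "\<bar>\<Sum>n. t n * a n\<bar> > e" if t: "\<And>n. \<bar>t n\<bar> \<le> 1" "\<And>n. n < N \<Longrightarrow> t n = s n" for t
    proof -
      have "(\<Sum>n<N. t n * a n) = (\<Sum>n<N. s n * a n)" using t(2) by simp
      moreover have "\<bar>\<Sum>n. t (n + N) * a (n + N)\<bar> < d / 2" "\<bar>\<Sum>n. s (n + N) * a (n + N)\<bar> < d / 2"
        using summable_bounded_mult(2)[OF aN, of "\<lambda>n. t (n + N)"] summable_bounded_mult(2)[OF aN, of "\<lambda>n. s (n + N)"]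
          tail t(1) s by auto
      ultimately have "\<bar>(\<Sum>n. s n * a n) - (\<Sum>n. t n * a n)\<bar> < d"
        using split[of t, OF t(1)] split[of s, OF s] by linarith
      then show ?thesis
        unfolding d_def by linarith
    qed
    then show "\<forall>t. (\<forall>n. \<bar>t n\<bar> \<le> 1) \<and> (\<forall>n<N. t n = s n) \<longrightarrow> \<bar>\<Sum>n. t n * a n\<bar> > e"
      by simp
  qed
qed

text \<open>This is Baire's theorem for the product \<open>[-1,1]\<^sup>\<nat>\<close>, carried out by hand. If each cylinder
  (the multipliers with prescribed first \<open>N\<close> entries) contained a multiplier whose value on some
  late \<open>a k\<close> exceeds \<open>e\<close> in modulus, then nested cylinders would shrink to a single multiplier with values
  above \<open>e\<close> in modulus on infinitely many \<open>a k\<close>.\<close>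

lemma l1_uniformly_small_on_cylinder:
  fixes a :: "nat \<Rightarrow> nat \<Rightarrow> real"
  assumes a: "\<And>k. summable (\<lambda>n. \<bar>a k n\<bar>)"
    and null: "\<And>s. (\<And>n. \<bar>s n\<bar> \<le> 1) \<Longrightarrow> (\<lambda>k. \<Sum>n. s n * a k n) \<longlonglongrightarrow> 0"
    and e: "e > 0"
  obtains m N s where "\<And>n. \<bar>s n\<bar> \<le> 1"
    "\<And>k t. k \<ge> m \<Longrightarrow> (\<And>n. \<bar>t n\<bar> \<le> 1) \<Longrightarrow> (\<And>n. n < N \<Longrightarrow> t n = s n) \<Longrightarrow> \<bar>\<Sum>n. t n * a k n\<bar> \<le> e"
proof (rule ccontr)
  assume no: "\<not> thesis"
  note cylinder = that
  have neg: "\<exists>k t. k \<ge> m \<and> (\<forall>n. \<bar>t n\<bar> \<le> 1) \<and> (\<forall>n<N. t n = s n) \<and> \<bar>\<Sum>n. t n * a k n\<bar> > e"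
    if s: "\<And>n. \<bar>s n\<bar> \<le> 1" for m N s
  proof (rule ccontr)
    assume *: "\<not> ?thesis"
    have thesis
    proof (rule cylinder[of s m N])
      show "\<bar>\<Sum>n. t n * a k n\<bar> \<le> e" if "k \<ge> m" "\<And>n. \<bar>t n\<bar> \<le> 1" "\<And>n. n < N \<Longrightarrow> t n = s n" for k t
      proof (rule ccontr)
        assume "\<not> ?thesis"
        then have "k \<ge> m \<and> (\<forall>n. \<bar>t n\<bar> \<le> 1) \<and> (\<forall>n<N. t n = s n) \<and> \<bar>\<Sum>n. t n * a k n\<bar> > e"
          using that by simp
        then show False using * by blast
      qed
    qed (rule s)
    then show False using no by blast
  qed
  define P where "P = (\<lambda>j (s, N). (\<forall>n. \<bar>s n\<bar> \<le> 1) \<and> N \<ge> j \<and>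
    (\<exists>k\<ge>j. \<forall>t. (\<forall>n. \<bar>t n\<bar> \<le> 1) \<and> (\<forall>n<N. t n = s n) \<longrightarrow> \<bar>\<Sum>n. t n * a k n\<bar> > e))"
  define Q where "Q = (\<lambda>(_::nat) (s :: nat \<Rightarrow> real, N :: nat) (s', N'). N \<le> N' \<and> (\<forall>n<N. s' n = s n))"
  have step: "\<exists>s' N'. P j (s', N') \<and> N \<le> N' \<and> (\<forall>n<N. s' n = s n)"
    if s: "\<And>n. \<bar>s n\<bar> \<le> 1" for j N s
  proof -
    obtain k t where k: "k \<ge> j" "\<And>n. \<bar>t n\<bar> \<le> 1" "\<And>n. n < N \<Longrightarrow> t n = s n" "\<bar>\<Sum>n. t n * a k n\<bar> > e"
      using neg[where s = s and m = j and N = N, OF s] by blast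
    obtain N' where N': "N' \<ge> max N j"
      "\<forall>t'. (\<forall>n. \<bar>t' n\<bar> \<le> 1) \<and> (\<forall>n<N'. t' n = t n) \<longrightarrow> \<bar>\<Sum>n. t' n * a k n\<bar> > e"
      by (rule l1_pairing_strict_bound_stable[where a = "a k" and s = t and M = "max N j", OF a k(2,4)])
        (rule that)
    have "P j (t, N')"
      unfolding P_def prod.case using k(1,2) N' by (intro conjI exI[of _ k]) simp_all
    then show ?thesis using k(3) N'(1) by (intro exI[of _ t] exI[of _ N']) simp
  qed
  have "\<exists>f. \<forall>j. P j (f j) \<and> Q j (f j) (f (Suc j))"
  proof (rule dependent_nat_choice)
    obtain s' N' where "P 0 (s', N')" using step[of "\<lambda>_. 0" 0 0] by force
    then show "\<exists>x. P 0 x" by blast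
    fix x j assume "P j x"
    then have "\<bar>fst x n\<bar> \<le> 1" for n by (simp add: P_def case_prod_unfold)
    then obtain s' N' where y: "P (Suc j) (s', N')" "snd x \<le> N'" "\<forall>n<snd x. s' n = fst x n"
      using step[of "fst x" "Suc j" "snd x"] by blast
    then have "Q j x (s', N')" by (simp add: Q_def case_prod_unfold)
    then show "\<exists>y. P (Suc j) y \<and> Q j x y" using y(1) by blast
  qed
  then obtain f where f: "\<And>j. P j (f j)" "\<And>j. Q j (f j) (f (Suc j))" by blast
  define s N where "s = (\<lambda>j. fst (f j))" and "N = (\<lambda>j. snd (f j))"
  have s1: "\<bar>s j n\<bar> \<le> 1" and Nj: "N j \<ge> j"
    and big: "\<exists>k\<ge>j. \<forall>t. (\<forall>n. \<bar>t n\<bar> \<le> 1) \<and> (\<forall>n<N j. t n = s j n) \<longrightarrow> \<bar>\<Sum>n. t n * a k n\<bar> > e" for j n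
    using f(1)[of j] unfolding P_def s_def N_def case_prod_unfold by blast+
  have next_le: "N j \<le> N (Suc j)" and next_eq: "n < N j \<Longrightarrow> s (Suc j) n = s j n" for j n
    using f(2)[of j] unfolding Q_def s_def N_def case_prod_unfold by blast+
  have mono: "N j \<le> N l" if "j \<le> l" for j l
    using lift_Suc_mono_le[of N, OF next_le that] .
  have agree: "s l n = s j n" if "j \<le> l" "n < N j" for j l n
    using that(1)
  proof (induction l rule: dec_induct)
    case (step l)
    then show ?case using next_eq[of n l] mono[of j l] that(2) by simp
  qed simp
  \<comment> \<open>The common point of the cylinders; its \<open>n\<close>-th entry is settled from stage \<open>Suc n\<close> on, as
    \<open>n < N (Suc n)\<close>.\<close>
  define t where "t = (\<lambda>n. s (Suc n) n)"
  have t_eq: "t n = s j n" if "n < N j" for j n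
  proof (cases "j \<le> Suc n")
    case True
    then show ?thesis using agree[OF True that] by (simp add: t_def)
  next
    case False
    then show ?thesis using agree[of "Suc n" j n] Nj[of "Suc n"] by (simp add: t_def)
  qed
  have t1: "\<bar>t n\<bar> \<le> 1" for n by (simp add: t_def s1)
  have "\<forall>\<^sub>F k in sequentially. \<bar>\<Sum>n. t n * a k n\<bar> < e"
    using tendstoD[OF null[of t, OF t1] e] by simp
  then obtain j where j: "\<And>k. k \<ge> j \<Longrightarrow> \<bar>\<Sum>n. t n * a k n\<bar> < e"
    by (auto simp: eventually_sequentially)
  obtain k where k: "k \<ge> j"
    "\<forall>t. (\<forall>n. \<bar>t n\<bar> \<le> 1) \<and> (\<forall>n<N j. t n = s j n) \<longrightarrow> \<bar>\<Sum>n. t n * a k n\<bar> > e"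
    using big[of j] by blast
  have "\<bar>\<Sum>n. t n * a k n\<bar> > e"
    by (rule k(2)[rule_format]) (use t1 t_eq in simp)
  then show False using j[OF k(1)] by simp
qed

text \<open>On a cylinder the entries from \<open>N\<close> on are free, and may be taken to be the signs of the
  entries of \<open>a k\<close>; this controls the tail of the \<open>\<ell>\<^sub>1\<close>-norm. The first \<open>N\<close> entries of \<open>a k\<close> tend
  to \<open>0\<close> one by one.\<close>

lemma l1_schur:
  fixes a :: "nat \<Rightarrow> nat \<Rightarrow> real"
  assumes a: "\<And>k. summable (\<lambda>n. \<bar>a k n\<bar>)"
    and null: "\<And>s. (\<And>n. \<bar>s n\<bar> \<le> 1) \<Longrightarrow> (\<lambda>k. \<Sum>n. s n * a k n) \<longlonglongrightarrow> 0"
  shows "(\<lambda>k. \<Sum>n. \<bar>a k n\<bar>) \<longlonglongrightarrow> 0"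
proof (rule tendstoI)
  fix e :: real assume e: "e > 0"
  obtain m N s where s: "\<And>n. \<bar>s n\<bar> \<le> 1" and
    small: "\<And>k t. k \<ge> m \<Longrightarrow> (\<And>n. \<bar>t n\<bar> \<le> 1) \<Longrightarrow> (\<And>n. n < N \<Longrightarrow> t n = s n) \<Longrightarrow> \<bar>\<Sum>n. t n * a k n\<bar> \<le> e / 2"
    by (rule l1_uniformly_small_on_cylinder[OF a null, of "e / 2"]) (use e in auto)
  have coord: "(\<lambda>k. a k i) \<longlonglongrightarrow> 0" for i
  proof -
    have "(\<Sum>n. (if n = i then 1 else 0) * a k n) = a k i" for k
      using suminf_finite[of "{i}" "\<lambda>n. (if n = i then 1 else 0) * a k n"] by simp
    then show ?thesis using null[of "\<lambda>n. if n = i then 1 else 0"] by simp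
  qed
  have "(\<lambda>k. 2 * (\<Sum>n<N. \<bar>a k n\<bar>)) \<longlonglongrightarrow> 2 * (\<Sum>n<N. \<bar>0\<bar>)"
    by (intro tendsto_intros coord)
  then have small_init: "\<forall>\<^sub>F k in sequentially. 2 * (\<Sum>n<N. \<bar>a k n\<bar>) < e / 2"
    using e by (intro order_tendstoD(2)[where y = "2 * (\<Sum>n<N. \<bar>0::real\<bar>)"]) auto
  have bound: "(\<Sum>n. \<bar>a k n\<bar>) \<le> e / 2 + 2 * (\<Sum>n<N. \<bar>a k n\<bar>)" if k: "k \<ge> m" for k
  proof -
    define t where "t = (\<lambda>n. if n < N then s n else sgn (a k n))"
    have t1: "\<bar>t n\<bar> \<le> 1" for n using s by (auto simp: t_def abs_sgn_eq)
    have "(\<Sum>n. \<bar>a k n\<bar>) - (\<Sum>n. t n * a k n) = (\<Sum>n. \<bar>a k n\<bar> - t n * a k n)"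
      by (rule suminf_diff[OF a summable_bounded_mult(1)[of "a k" t, OF a t1]])
    also have "\<dots> = (\<Sum>n<N. \<bar>a k n\<bar> - t n * a k n)"
      by (rule suminf_finite) (auto simp: t_def abs_sgn mult.commute)
    also have "\<dots> \<le> (\<Sum>n<N. 2 * \<bar>a k n\<bar>)"
    proof (rule sum_mono)
      fix n
      have "\<bar>t n * a k n\<bar> \<le> \<bar>a k n\<bar>"
        using mult_right_mono[OF t1, of "\<bar>a k n\<bar>" n] by (simp add: abs_mult)
      then show "\<bar>a k n\<bar> - t n * a k n \<le> 2 * \<bar>a k n\<bar>" by linarith
    qed
    finally have "(\<Sum>n. \<bar>a k n\<bar>) \<le> (\<Sum>n. t n * a k n) + 2 * (\<Sum>n<N. \<bar>a k n\<bar>)"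
      by (simp add: sum_distrib_left)
    moreover have "\<bar>\<Sum>n. t n * a k n\<bar> \<le> e / 2"
      by (rule small[of k t, OF k t1]) (simp add: t_def)
    ultimately show ?thesis by linarith
  qed
  show "\<forall>\<^sub>F k in sequentially. dist (\<Sum>n. \<bar>a k n\<bar>) 0 < e"
    using small_init eventually_ge_at_top[of m]
  proof eventually_elim
    case (elim k)
    have "0 \<le> (\<Sum>n. \<bar>a k n\<bar>)" by (rule suminf_nonneg[OF a]) simp
    then show ?case using bound[OF elim(2)] elim(1) unfolding dist_real_def by linarith
  qed
qed


section \<open>Weakly 1-summable sequences in a dual space\<close>

lemma weak_l1_dual_summable:
  fixes z :: "('x::real_normed_vector \<Rightarrow>\<^sub>L real) weak_l1"
  shows "summable (\<lambda>n. \<bar>weak_l1_nth z n x\<bar>)"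
  using summable_weak_l1_nth[of "Blinfun (\<lambda>f. blinfun_apply f x)" z]
  by (simp add: bounded_linear_Blinfun_apply blinfun.bounded_linear_left)

text \<open>Evaluation at \<open>x\<close> is a functional on \<open>X\<^sup>*\<close> of norm at most \<open>\<parallel>x\<parallel>\<close>.\<close>

lemma weak_l1_dual_le:
  fixes z :: "('x::real_normed_vector \<Rightarrow>\<^sub>L real) weak_l1"
  shows "(\<Sum>n. \<bar>weak_l1_nth z n x\<bar>) \<le> norm z * norm x"
proof (cases "x = 0")
  case False
  define y where "y = x /\<^sub>R norm x"
  have y: "norm y = 1" "x = norm x *\<^sub>R y" using False by (simp_all add: y_def)
  define E where "E = Blinfun (\<lambda>f :: 'x \<Rightarrow>\<^sub>L real. blinfun_apply f y)"
  have E: "blinfun_apply E f = blinfun_apply f y" for f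
    by (simp add: E_def bounded_linear_Blinfun_apply blinfun.bounded_linear_left)
  have "norm E \<le> 1"
  proof (rule norm_blinfun_bound)
    show "norm (E f) \<le> 1 * norm f" for f using norm_blinfun[of f y] y(1) by (simp add: E)
  qed simp
  then have "(\<Sum>n. \<bar>weak_l1_nth z n y\<bar>) \<le> norm z"
    using weak_l1_norm_upper[of E z] by (simp add: E norm_weak_l1_def)
  then have "norm x * (\<Sum>n. \<bar>weak_l1_nth z n y\<bar>) \<le> norm x * norm z"
    by (rule mult_left_mono) simp
  also have "norm x * (\<Sum>n. \<bar>weak_l1_nth z n y\<bar>) = (\<Sum>n. \<bar>weak_l1_nth z n x\<bar>)"
    by (subst (2) y(2))
      (simp add: blinfun.scaleR_right abs_mult suminf_mult[OF weak_l1_dual_summable])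
  finally show ?thesis by (simp add: mult.commute)
qed (simp add: blinfun.zero_right)

text \<open>The unit ball of \<open>X\<close> already norms \<open>\<ell>\<^sub>1\<^sup>w(X\<^sup>*)\<close>: for a functional \<open>f\<close> on \<open>X\<^sup>*\<close> of norm at most
  \<open>1\<close> the sum of the first \<open>\<bar>f z\<^sub>n\<bar>\<close> is the value of \<open>f\<close> at a signed sum of the \<open>z\<^sub>n\<close>, and the norm of
  that signed sum in \<open>X\<^sup>*\<close> is computed on \<open>X\<close>.\<close>

lemma weak_l1_dual_norm_least:
  fixes z :: "('x::real_normed_vector \<Rightarrow>\<^sub>L real) weak_l1"
  assumes C: "\<And>x. norm x \<le> 1 \<Longrightarrow> (\<Sum>n. \<bar>weak_l1_nth z n x\<bar>) \<le> C"
  shows "norm z \<le> C"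
  unfolding norm_weak_l1_def
proof (intro weak_l1_norm_least suminf_le_const summable_weak_l1_nth)
  fix f :: "('x \<Rightarrow>\<^sub>L real) \<Rightarrow>\<^sub>L real" and N
  assume f: "norm f \<le> 1"
  define w where "w = (\<Sum>n<N. sgn (f (weak_l1_nth z n)) *\<^sub>R weak_l1_nth z n)"
  have "norm w \<le> C"
  proof (rule norm_blinfun_le_unit_ball)
    fix x :: 'x assume x: "norm x \<le> 1"
    have "norm (w x) \<le> (\<Sum>n<N. \<bar>sgn (f (weak_l1_nth z n)) * weak_l1_nth z n x\<bar>)"
      unfolding w_def blinfun.sum_left blinfun.scaleR_left real_norm_def real_scaleR_def by (rule sum_abs)
    also have "\<dots> \<le> (\<Sum>n<N. \<bar>weak_l1_nth z n x\<bar>)"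
      by (intro sum_mono) (simp add: abs_mult abs_sgn_eq)
    also have "\<dots> \<le> (\<Sum>n. \<bar>weak_l1_nth z n x\<bar>)"
      by (intro sum_le_suminf weak_l1_dual_summable) auto
    also have "\<dots> \<le> C" by (rule C[OF x])
    finally show "norm (w x) \<le> C" .
  qed
  have "(\<Sum>n<N. \<bar>f (weak_l1_nth z n)\<bar>) = f w"
    by (simp add: w_def blinfun.sum_right blinfun.scaleR_right abs_sgn mult.commute)
  also have "\<dots> \<le> norm f * norm w" using norm_blinfun[of f w] by simp
  also have "\<dots> \<le> 1 * norm w" using f by (rule mult_right_mono) simp
  finally show "(\<Sum>n<N. \<bar>f (weak_l1_nth z n)\<bar>) \<le> C" using \<open>norm w \<le> C\<close> by simp
qed

text \<open>The series \<open>\<Sum>n. s\<^sub>n z\<^sub>n\<close> converges weak-star, which is why its sum is described by its values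
  on \<open>X\<close>; it need not converge in norm.\<close>

lemma weak_l1_dual_pairing:
  fixes s :: "nat \<Rightarrow> real"
  assumes s: "\<And>n. \<bar>s n\<bar> \<le> 1"
  obtains A :: "('x::real_normed_vector \<Rightarrow>\<^sub>L real) weak_l1 \<Rightarrow> 'x \<Rightarrow>\<^sub>L real"
  where "bounded_linear A" "\<And>z x. blinfun_apply (A z) x = (\<Sum>n. s n * blinfun_apply (weak_l1_nth z n) x)"
proof -
  define A where "A = (\<lambda>z :: ('x \<Rightarrow>\<^sub>L real) weak_l1. Blinfun (\<lambda>x. \<Sum>n. s n * blinfun_apply (weak_l1_nth z n) x))"
  note sm = summable_bounded_mult[where s = s, OF weak_l1_dual_summable s]
  have le: "\<bar>\<Sum>n. s n * weak_l1_nth z n x\<bar> \<le> norm z * norm x" for z :: "('x \<Rightarrow>\<^sub>L real) weak_l1" and x :: 'x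
    by (rule order.trans[OF sm(2) weak_l1_dual_le])
  have "bounded_linear (\<lambda>x. \<Sum>n. s n * weak_l1_nth z n x)" for z :: "('x \<Rightarrow>\<^sub>L real) weak_l1"
  proof (rule bounded_linear_intro[where K = "norm z"])
    fix x y :: 'x and r :: real
    show "(\<Sum>n. s n * weak_l1_nth z n (x + y)) = (\<Sum>n. s n * weak_l1_nth z n x) + (\<Sum>n. s n * weak_l1_nth z n y)"
      by (simp add: blinfun.add_right distrib_left suminf_add[OF sm(1) sm(1)])
    show "(\<Sum>n. s n * weak_l1_nth z n (r *\<^sub>R x)) = r *\<^sub>R (\<Sum>n. s n * weak_l1_nth z n x)"
      by (simp add: blinfun.scaleR_right suminf_mult[OF sm(1), symmetric] mult.left_commute)
    show "norm (\<Sum>n. s n * weak_l1_nth z n x) \<le> norm x * norm z"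
      using le[of z x] by (simp add: mult.commute)
  qed
  then have A: "A z x = (\<Sum>n. s n * weak_l1_nth z n x)" for z :: "('x \<Rightarrow>\<^sub>L real) weak_l1" and x
    by (simp add: A_def bounded_linear_Blinfun_apply)
  have "bounded_linear A"
  proof (rule bounded_linear_intro[where K = 1])
    fix y z :: "('x \<Rightarrow>\<^sub>L real) weak_l1" and r :: real
    show "A (y + z) = A y + A z"
      by (rule blinfun_eqI)
        (simp add: A blinfun.add_left plus_weak_l1.rep_eq distrib_left suminf_add[OF sm(1) sm(1)])
    show "A (r *\<^sub>R z) = r *\<^sub>R A z"
      by (rule blinfun_eqI)
        (simp add: A blinfun.scaleR_left scaleR_weak_l1.rep_eq suminf_mult[OF sm(1), symmetric] mult.left_commute)
    show "norm (A z) \<le> norm z * 1"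
      using le by (intro norm_blinfun_bound) (auto simp: A)
  qed
  then show ?thesis using A by (rule that)
qed

theorem DPrcP_weak_l1:
  assumes X: "DPrcP p TYPE('x::banach \<Rightarrow>\<^sub>L real)"
  shows "DPrcP p TYPE(('x \<Rightarrow>\<^sub>L real) weak_l1)"
  unfolding DPrcP_def
proof (intro allI impI, elim conjE)
  fix u :: "nat \<Rightarrow> ('x \<Rightarrow>\<^sub>L real) weak_l1"
  assume u: "weakly_summable p u" "dunford_pettis_set (range u)"
  show "u \<longlonglongrightarrow> 0"
  proof (rule null_if_null_along_unit_ball[where \<phi> = "\<lambda>k x. \<Sum>n. \<bar>weak_l1_nth (u k) n x\<bar>"])
    show "norm (u k) \<le> C" if "\<And>x. norm x \<le> 1 \<Longrightarrow> (\<Sum>n. \<bar>weak_l1_nth (u k) n x\<bar>) \<le> C" for k C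
      using that by (rule weak_l1_dual_norm_least)
    show "0 \<le> (\<Sum>n. \<bar>weak_l1_nth (u k) n x\<bar>)" for k x
      by (rule suminf_nonneg[OF weak_l1_dual_summable]) simp
    fix x :: "nat \<Rightarrow> 'x"
    assume x: "\<And>k. norm (x k) \<le> 1"
    show "(\<lambda>k. \<Sum>n. \<bar>weak_l1_nth (u k) n (x k)\<bar>) \<longlonglongrightarrow> 0"
    proof (rule l1_schur)
      show "summable (\<lambda>n. \<bar>weak_l1_nth (u k) n (x k)\<bar>)" for k
        by (rule weak_l1_dual_summable)
      fix s :: "nat \<Rightarrow> real" assume s: "\<And>n. \<bar>s n\<bar> \<le> 1"
      obtain A :: "('x \<Rightarrow>\<^sub>L real) weak_l1 \<Rightarrow> 'x \<Rightarrow>\<^sub>L real"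
        where A: "bounded_linear A" "\<And>z x. blinfun_apply (A z) x = (\<Sum>n. s n * blinfun_apply (weak_l1_nth z n) x)"
        by (rule weak_l1_dual_pairing[where s = s, OF s]) (rule that)
      have null: "(\<lambda>k. norm (A (u k))) \<longlonglongrightarrow> 0"
        by (intro tendsto_norm_zero DPrcP_image_null[OF X A(1) u])
      have bound: "norm (A (u k) (x k)) \<le> norm (A (u k))" for k
        using norm_blinfun[of "A (u k)" "x k"] mult_left_le[OF x[of k] norm_ge_zero[of "A (u k)"]] by simp
      have "(\<lambda>k. A (u k) (x k)) \<longlonglongrightarrow> 0"
        by (rule Lim_null_comparison[OF always_eventually[OF allI[OF bound]] null])
      then show "(\<lambda>k. \<Sum>n. s n * weak_l1_nth (u k) n (x k)) \<longlonglongrightarrow> 0"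
        by (simp add: A(2))
    qed
  qed
qed


theorem corollary3p14:
  fixes p :: real
  assumes "1 \<le> p"
  shows
    "(DPrcP p TYPE('x::banach \<Rightarrow>\<^sub>L real) \<and> schur_property TYPE('y::banach)
        \<longrightarrow> DPrcP p TYPE('x \<Rightarrow>\<^sub>L 'y)) \<and>
     (DPrcP p TYPE('x) \<and> schur_property TYPE('y)
        \<longrightarrow> DPrcP p TYPE(('x, 'y) wstar_op)) \<and>
     (DPrcP p TYPE('x \<Rightarrow>\<^sub>L real)
        \<longrightarrow> DPrcP p TYPE(('x \<Rightarrow>\<^sub>L real) weak_l1))"
  by (intro conjI impI) (simp_all add: DPrcP_blinfun DPrcP_wstar_op DPrcP_weak_l1)

end
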